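(* Let $w(z)=e^{-2\phi(|z|)}$, $z\in\mathbb{D}$, be a radial weight such that $\phi:[0,1)\to\mathbb{R}^+$ is a $C^\infty$-function, $\phi'$ is positive on $[0,1)$, $\lim_{r\to1^-}\phi(r)=\lim_{r\to1^-}\phi'(r)=+\infty$, and $$\lim_{r\to1^-}\frac{\phi^{(n)}(r)}{\left(\phi'(r)\right)^n}=0\quad\text{for every integer } n\ge2.$$ Then, for $0<p<\infty$, the Bergman projection $P_w$ is bounded from $L^p(\mathbb{D},w)$ to $L^p(\mathbb{D},w)$ only for $p=2$.
   Context: $\mathbb{D}$ is the open unit disc in $\mathbb{C}$, $dm(z)=\frac{dx\,dy}{\pi}$ is normalized area measure, $\mathbb{R}^+=[0,\infty)$. A weight is an integrable function $w:\mathbb{D}\to(0,\infty)$; it is radial if $w(z)=w(|z|)$. $L^p(\mathbb{D},w)$ is the space of measurable $f$ with $\|f\|_{L^p(\mathbb{D},w)}^p=\int_{\mathbb{D}}|f|^pw\,dm<\infty$. $A^2_w$ is the (closed) subspace of analytic functions in $L^2(\mathbb{D},w)$, and the Bergman projection $P_w$ is the orthogonal projection of $L^2(\mathbb{D},w)$ onto $A^2_w$, given by $P_wf(z)=\int_{\mathbb{D}}f(\zeta)\overline{K_z(\zeta)}w(\zeta)\,dm(\zeta)$, where $K_z$ is the reproducing kernel of $A^2_w$ at $z$. $P_w$ being bounded from $L^p(\mathbb{D},w)$ to $L^p(\mathbb{D},w)$ means that there is a constant $C$ with $\|P_wf\|_{L^p(\mathbb{D},w)}\le C\|f\|_{L^p(\mathbb{D},w)}$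 for all $f\in L^2(\mathbb{D},w)\cap L^p(\mathbb{D},w)$. *)

theory Defs
  imports "HOL-Analysis.Analysis"
begin

definition disc_measure :: "complex measure" where
  "disc_measure = density (lebesgue_on (ball 0 1)) (\<lambda>_. ennreal (1 / pi))"

definition weight :: "(complex \<Rightarrow> real) \<Rightarrow> bool" where
  "weight w \<longleftrightarrow> (\<forall>z\<in>ball 0 1. w z > 0) \<and> integrable disc_measure w"

definition radial :: "(complex \<Rightarrow> real) \<Rightarrow> bool" where
  "radial w \<longleftrightarrow> (\<forall>z\<in>ball 0 1. w z = w (of_real (cmod z)))"

definition Lp_space :: "real \<Rightarrow> (complex \<Rightarrow> real) \<Rightarrow> (complex \<Rightarrow> complex) set" where
  "Lp_space p w = {f \<in> borel_measurable disc_measure.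
     integrable disc_measure (\<lambda>z. cmod (f z) powr p * w z)}"

text \<open>Only meaningful for members of \<^const>\<open>Lp_space\<close>: the Bochner integral of a
  non-integrable function is 0.\<close>

definition Lp_norm :: "real \<Rightarrow> (complex \<Rightarrow> real) \<Rightarrow> (complex \<Rightarrow> complex) \<Rightarrow> real" where
  "Lp_norm p w f = (LINT z|disc_measure. cmod (f z) powr p * w z) powr (1 / p)"

definition L2_inner ::
  "(complex \<Rightarrow> real) \<Rightarrow> (complex \<Rightarrow> complex) \<Rightarrow> (complex \<Rightarrow> complex) \<Rightarrow> complex" where
  "L2_inner w f g = (LINT z|disc_measure. f z * cnj (g z) * of_real (w z))"

definition bergman_space :: "(complex \<Rightarrow> real) \<Rightarrow> (complex \<Rightarrow> complex) set" where
  "bergman_space w = {f \<in> Lp_space 2 w. f holomorphic_on ball 0 1}"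

text \<open>Functions on the disc are represented by total functions whose values off the disc are
  irrelevant; the projection is normalised to vanish there so that it is unique.\<close>

definition bergman_projection ::
  "(complex \<Rightarrow> real) \<Rightarrow> (complex \<Rightarrow> complex) \<Rightarrow> complex \<Rightarrow> complex" where
  "bergman_projection w f = (THE g. g \<in> bergman_space w \<and> (\<forall>z. z \<notin> ball 0 1 \<longrightarrow> g z = 0) \<and>
     (\<forall>h\<in>bergman_space w. L2_inner w (\<lambda>z. f z - g z) h = 0))"

definition bergman_projection_bounded :: "real \<Rightarrow> (complex \<Rightarrow> real) \<Rightarrow> bool" where
  "bergman_projection_bounded p w \<longleftrightarrow> (\<exists>C. \<forall>f \<in> Lp_space 2 w \<inter> Lp_space p w.
     bergman_projection w f \<in> Lp_space p w \<and>
     Lp_norm p w (bergman_projection w f) \<le> C * Lp_norm p w f)"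

text \<open>Iterated derivatives relative to \<open>S\<close>, hence one-sided at boundary points of an interval.\<close>

primrec nth_deriv_within :: "real set \<Rightarrow> nat \<Rightarrow> (real \<Rightarrow> real) \<Rightarrow> real \<Rightarrow> real" where
  "nth_deriv_within S 0 f = f"
| "nth_deriv_within S (Suc n) f =
     (\<lambda>x. vector_derivative (nth_deriv_within S n f) (at x within S))"

definition smooth_within :: "real set \<Rightarrow> (real \<Rightarrow> real) \<Rightarrow> bool" where
  "smooth_within S f \<longleftrightarrow> (\<forall>n. nth_deriv_within S n f differentiable_on S)"

end

theory Submission
  imports Defs "HOL-Complex_Analysis.Complex_Analysis"
begin

text \<open>
  For the test functions \<open>f z = \<bar>z\<bar>\<^bsup>2n/p\<^esup> (sgn z)\<^sup>n\<close> one has \<open>P\<^sub>w f = c z\<^sup>n\<close>, so boundedness of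
  \<open>P\<^sub>w\<close> forces \<open>M((1 + 2/p) n) M(p n)\<^bsup>1/p\<^esup> \<le> C M(2 n)\<^bsup>1 + 1/p\<^esup>\<close> for the moments
  \<open>M x = \<integral>\<bar>z\<bar>\<^sup>x w dm\<close>. Since \<open>ln M\<close> is convex and \<open>2\<close> is the weighted mean of \<open>1 + 2/p\<close> and
  \<open>p\<close>, this reverses a convexity inequality up to a constant, and for \<open>p \<noteq> 2\<close> the three points are
  distinct: on geometric scales the slope of \<open>ln M\<close> at \<open>n\<close> changes by only \<open>O(1/n)\<close>. As the slopes tend to \<open>0\<close>, they are
  \<open>O(1/n)\<close> themselves, and \<open>M\<close> decays at most like a power of \<open>n\<close>. On the other hand
  \<open>\<phi>''/\<phi>'\<^sup>2 \<rightarrow> 0\<close> gives \<open>(1 - r) \<phi>'(r) \<rightarrow> \<infinity>\<close>, so \<open>w\<close> vanishes at the boundary faster than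
  every power of \<open>1 - \<bar>z\<bar>\<close> and \<open>M\<close> decays faster than every power of \<open>n\<close>. For \<open>p = 2\<close> the
  projection is built as a power series whose coefficients are controlled by Bessel's inequality.
\<close>

section \<open>Bergman spaces of rotation invariant measures\<close>

text \<open>The weight is absorbed into the measure, so the Hilbert space part rests on finiteness,
  rotation invariance and positivity on open sets. Only measurability of the identity links the
  sigma-algebra to the Borel sets, which leaves room for completed measures; rotation is therefore
  tested on Borel functions.\<close>

locale radial_disc_measure = finite_measure \<nu> for \<nu> :: "complex measure" +
  assumes space_eq: "space \<nu> = ball 0 1"
    and measurable_id: "(\<lambda>z. z) \<in> borel_measurable \<nu>"
    and rotation: "\<And>c (f :: complex \<Rightarrow> complex). \<lbrakk>cmod c = 1; f \<in> borel_measurable borel\<rbrakk> \<Longrightarrow>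
      (\<integral>z. f (c * z) \<partial>\<nu>) = (\<integral>z. f z \<partial>\<nu>)"
    and open_pos: "\<And>U. \<lbrakk>open U; U \<noteq> {}; U \<subseteq> ball 0 1\<rbrakk> \<Longrightarrow> emeasure \<nu> U \<noteq> 0"
begin

lemma measurable_borel: "f \<in> borel_measurable borel \<Longrightarrow> f \<in> borel_measurable \<nu>"
  using measurable_compose[OF measurable_id] by blast

lemma measurable_continuous_on:
  fixes f :: "complex \<Rightarrow> 'b::{real_normed_vector, second_countable_topology}"
  assumes "continuous_on (ball 0 1) f"
  shows "f \<in> borel_measurable \<nu>"
proof -
  have "(\<lambda>z. indicator (ball 0 1) z *\<^sub>R f z) \<in> borel_measurable borel"
    using assms by (intro borel_measurable_continuous_on_indicator) auto
  then have "(\<lambda>z. indicator (ball 0 1) z *\<^sub>R f z) \<in> borel_measurable \<nu>"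
    by (rule measurable_borel)
  moreover have "f \<in> borel_measurable \<nu> \<longleftrightarrow> (\<lambda>z. indicator (ball 0 1) z *\<^sub>R f z) \<in> borel_measurable \<nu>"
    by (rule measurable_cong) (auto simp: space_eq)
  ultimately show ?thesis by simp
qed

lemma integrable_bounded:
  fixes f :: "complex \<Rightarrow> 'b::{banach, second_countable_topology}"
  assumes "f \<in> borel_measurable \<nu>" "\<And>z. cmod z < 1 \<Longrightarrow> norm (f z) \<le> B"
  shows "integrable \<nu> f"
  using assms by (intro integrable_const_bound[where B=B]) (auto intro!: AE_I2 simp: space_eq)

section \<open>Inner product and square norm\<close>

definition ip :: "(complex \<Rightarrow> complex) \<Rightarrow> (complex \<Rightarrow> complex) \<Rightarrow> complex" where
  "ip f g = (\<integral>z. f z * cnj (g z) \<partial>\<nu>)"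

definition sqnorm :: "(complex \<Rightarrow> complex) \<Rightarrow> real" where
  "sqnorm f = (\<integral>z. (cmod (f z))\<^sup>2 \<partial>\<nu>)"

definition L2 :: "(complex \<Rightarrow> complex) set" where
  "L2 = {f \<in> borel_measurable \<nu>. integrable \<nu> (\<lambda>z. (cmod (f z))\<^sup>2)}"

definition A2 :: "(complex \<Rightarrow> complex) set" where
  "A2 = {f \<in> L2. f holomorphic_on ball 0 1}"

lemma L2_measurable: "f \<in> L2 \<Longrightarrow> f \<in> borel_measurable \<nu>"
  and L2_integrable: "f \<in> L2 \<Longrightarrow> integrable \<nu> (\<lambda>z. (cmod (f z))\<^sup>2)"
  by (auto simp: L2_def)

lemma A2_L2: "f \<in> A2 \<Longrightarrow> f \<in> L2"
  by (auto simp: A2_def)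

lemma bounded_L2:
  assumes "f \<in> borel_measurable \<nu>" "\<And>z. cmod z < 1 \<Longrightarrow> cmod (f z) \<le> B"
  shows "f \<in> L2"
proof -
  have "integrable \<nu> (\<lambda>z. (cmod (f z))\<^sup>2)"
    using assms(1) by (rule_tac integrable_bounded[where B="B\<^sup>2"]) (auto intro!: power_mono assms(2))
  with assms show ?thesis by (simp add: L2_def)
qed

lemma integrable_mult:
  assumes "f \<in> L2" "g \<in> L2"
  shows "integrable \<nu> (\<lambda>z. f z * cnj (g z))"
proof (rule Bochner_Integration.integrable_bound)
  show "integrable \<nu> (\<lambda>z. (cmod (f z))\<^sup>2 + (cmod (g z))\<^sup>2)"
    using assms by (intro Bochner_Integration.integrable_add L2_integrable)
  show "(\<lambda>z. f z * cnj (g z)) \<in> borel_measurable \<nu>"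
    using assms[THEN L2_measurable] borel_measurable_continuous_onI[OF continuous_on_cnj[OF continuous_on_id]]
    by (auto intro!: borel_measurable_times intro: measurable_compose)
  have "cmod (f z) * cmod (g z) \<le> (cmod (f z))\<^sup>2 + (cmod (g z))\<^sup>2" for z
    using sum_squares_bound[of "cmod (f z)" "cmod (g z)"]
      mult_nonneg_nonneg[OF norm_ge_zero norm_ge_zero, of "f z" "g z"] by linarith
  then show "AE z in \<nu>. norm (f z * cnj (g z)) \<le> norm ((cmod (f z))\<^sup>2 + (cmod (g z))\<^sup>2)"
    by (intro AE_I2) (simp add: norm_mult)
qed

lemma L2_add: assumes "f \<in> L2" "g \<in> L2" shows "(\<lambda>z. f z + g z) \<in> L2"
proof -
  have "integrable \<nu> (\<lambda>z. (cmod (f z + g z))\<^sup>2)"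
  proof (rule Bochner_Integration.integrable_bound)
    show "integrable \<nu> (\<lambda>z. 2 * (cmod (f z))\<^sup>2 + 2 * (cmod (g z))\<^sup>2)"
      using assms by (intro Bochner_Integration.integrable_add integrable_mult_right L2_integrable)
    show "(\<lambda>z. (cmod (f z + g z))\<^sup>2) \<in> borel_measurable \<nu>"
      using assms[THEN L2_measurable] by measurable
    have "(cmod (f z + g z))\<^sup>2 \<le> 2 * (cmod (f z))\<^sup>2 + 2 * (cmod (g z))\<^sup>2" for z
    proof -
      have "(cmod (f z + g z))\<^sup>2 \<le> (cmod (f z) + cmod (g z))\<^sup>2"
        by (intro power_mono norm_triangle_ineq) auto
      also have "\<dots> \<le> 2 * (cmod (f z))\<^sup>2 + 2 * (cmod (g z))\<^sup>2"
        using sum_squares_bound[of "cmod (f z)" "cmod (g z)"] by (simp add: power2_sum)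
      finally show ?thesis .
    qed
    then show "AE z in \<nu>. norm ((cmod (f z + g z))\<^sup>2) \<le> norm (2 * (cmod (f z))\<^sup>2 + 2 * (cmod (g z))\<^sup>2)"
      by (intro AE_I2) simp
  qed
  then show ?thesis using assms[THEN L2_measurable] by (auto simp: L2_def)
qed

lemma L2_scale: assumes "f \<in> L2" shows "(\<lambda>z. c * f z) \<in> L2"
  using assms by (auto simp: L2_def norm_mult power_mult_distrib)

lemma L2_diff: "\<lbrakk>f \<in> L2; g \<in> L2\<rbrakk> \<Longrightarrow> (\<lambda>z. f z - g z) \<in> L2"
  using L2_add[of f "\<lambda>z. (-1) * g z"] L2_scale[of g "-1"] by simp

lemma L2_sum: "(\<And>k. k \<in> I \<Longrightarrow> f k \<in> L2) \<Longrightarrow> (\<lambda>z. \<Sum>k\<in>I. f k z) \<in> L2"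
proof (induction I rule: infinite_finite_induct)
  case (insert k I)
  then show ?case using L2_add[of "f k" "\<lambda>z. \<Sum>k\<in>I. f k z"] by simp
qed (auto intro: bounded_L2[where B=0])

lemma continuous_bounded_L2:
  assumes "continuous_on (ball 0 1) f" "\<And>z. cmod z < 1 \<Longrightarrow> cmod (f z) \<le> B"
  shows "f \<in> L2"
  using assms by (intro bounded_L2 measurable_continuous_on)

lemma L2_power: "(\<lambda>z. z ^ k) \<in> L2"
  by (rule continuous_bounded_L2[where B=1])
     (auto intro!: continuous_intros power_le_one simp: norm_power)

lemma ip_diff_left: "\<lbrakk>f \<in> L2; g \<in> L2; h \<in> L2\<rbrakk> \<Longrightarrow> ip (\<lambda>z. f z - g z) h = ip f h - ip g h"
  by (simp add: ip_def left_diff_distrib integrable_mult)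

lemma ip_diff_right: "\<lbrakk>f \<in> L2; g \<in> L2; h \<in> L2\<rbrakk> \<Longrightarrow> ip h (\<lambda>z. f z - g z) = ip h f - ip h g"
  by (simp add: ip_def right_diff_distrib integrable_mult)

lemma ip_scale_left: "ip (\<lambda>z. c * f z) h = c * ip f h"
  by (simp add: ip_def mult.assoc)

lemma ip_scale_right: "ip h (\<lambda>z. c * f z) = cnj c * ip h f"
  unfolding ip_def by (subst integral_mult_right_zero[symmetric]) (simp add: mult_ac)

lemma ip_sum_left:
  "\<lbrakk>\<And>k. k \<in> I \<Longrightarrow> f k \<in> L2; h \<in> L2\<rbrakk> \<Longrightarrow> ip (\<lambda>z. \<Sum>k\<in>I. f k z) h = (\<Sum>k\<in>I. ip (f k) h)"
  by (simp add: ip_def sum_distrib_right integrable_mult)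

lemma ip_sum_right:
  "\<lbrakk>\<And>k. k \<in> I \<Longrightarrow> f k \<in> L2; h \<in> L2\<rbrakk> \<Longrightarrow> ip h (\<lambda>z. \<Sum>k\<in>I. f k z) = (\<Sum>k\<in>I. ip h (f k))"
  by (simp add: ip_def sum_distrib_left integrable_mult)

lemma ip_self: "ip f f = of_real (sqnorm f)"
  unfolding ip_def sqnorm_def
  by (subst integral_complex_of_real[symmetric]) (simp only: complex_norm_square)

lemma ip_commute: "ip g f = cnj (ip f g)"
  unfolding ip_def by (subst Bochner_Integration.integral_cnj[symmetric]) (simp add: mult.commute)

lemma sqnorm_nonneg: "sqnorm f \<ge> 0"
  by (simp add: sqnorm_def)

lemma sqnorm_diff:
  assumes "f \<in> L2" "g \<in> L2"
  shows "sqnorm (\<lambda>z. f z - g z) = sqnorm f - 2 * Re (ip f g) + sqnorm g"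
proof -
  have "of_real (sqnorm (\<lambda>z. f z - g z)) = ip f f - ip f g - (ip g f - ip g g)"
    using assms by (simp add: ip_self[symmetric] ip_diff_left ip_diff_right L2_diff)
  then have "Re (of_real (sqnorm (\<lambda>z. f z - g z))) = Re (ip f f - ip f g - (ip g f - ip g g))"
    by simp
  then show ?thesis using ip_commute[of g f] by (simp add: ip_self)
qed

text \<open>A weighted arithmetic-geometric mean inequality in the role of Cauchy-Schwarz: the free
  factor \<open>t\<close> lets the first term be made small before the second.\<close>

lemma ip_bound:
  assumes "f \<in> L2" "g \<in> L2" "t > 0"
  shows "cmod (ip f g) \<le> t * sqnorm f + sqnorm g / t"
proof -
  have "cmod (ip f g) \<le> (\<integral>z. t * (cmod (f z))\<^sup>2 + (cmod (g z))\<^sup>2 / t \<partial>\<nu>)"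
    unfolding ip_def
  proof (rule order_trans[OF integral_norm_bound integral_mono])
    show "integrable \<nu> (\<lambda>z. cmod (f z * cnj (g z)))"
      using assms by (intro integrable_norm integrable_mult)
    show "integrable \<nu> (\<lambda>z. t * (cmod (f z))\<^sup>2 + (cmod (g z))\<^sup>2 / t)"
      using assms by (auto intro!: Bochner_Integration.integrable_add L2_integrable)
    fix z
    \<comment> \<open>Splitting \<open>sqrt t\<close> between the factors keeps \<open>a * b\<close>
      equal to the product of the two moduli.\<close>
    define a b where "a = sqrt t * cmod (f z)" and "b = cmod (g z) / sqrt t"
    have "0 \<le> a" "0 \<le> b" using assms by (auto simp: a_def b_def)
    then have "a * b \<le> a\<^sup>2 + b\<^sup>2"
      using sum_squares_bound[of a b] mult_nonneg_nonneg[of a b] by linarith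
    then show "cmod (f z * cnj (g z)) \<le> t * (cmod (f z))\<^sup>2 + (cmod (g z))\<^sup>2 / t"
      using assms by (simp add: a_def b_def norm_mult power_mult_distrib power_divide)
  qed
  also have "\<dots> = t * sqnorm f + sqnorm g / t"
    using assms by (simp add: sqnorm_def L2_integrable)
  finally show ?thesis .
qed

lemma ip_tendsto_zero:
  assumes "f \<in> L2" "\<And>n. g n \<in> L2" "(\<lambda>n. sqnorm (g n)) \<longlonglongrightarrow> 0"
  shows "(\<lambda>n. ip f (g n)) \<longlonglongrightarrow> 0"
proof (rule LIMSEQ_I)
  fix r :: real assume r: "r > 0"
  \<comment> \<open>The \<open>+ 1\<close> keeps the denominator positive when
    \<open>sqnorm f = 0\<close> and puts the first term of \<open>ip_bound\<close> strictly below
    \<open>r / 2\<close>.\<close>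
  define t where "t = r / (2 * (sqnorm f + 1))"
  have t: "t > 0" and "t * (sqnorm f + 1) = r / 2"
    using r sqnorm_nonneg[of f] by (auto simp: t_def divide_simps add_pos_nonneg)
  then have tf: "t * sqnorm f < r / 2" by (simp add: ring_distribs)
  obtain N where N: "\<And>n. n \<ge> N \<Longrightarrow> norm (sqnorm (g n) - 0) < t * (r / 2)"
    using LIMSEQ_D[OF assms(3), of "t * (r/2)"] t r by auto
  have "norm (ip f (g n) - 0) < r" if "n \<ge> N" for n
  proof -
    have "sqnorm (g n) / t < r / 2"
      using N[OF that] t sqnorm_nonneg[of "g n"] by (simp add: pos_divide_less_eq mult.commute)
    with ip_bound[OF assms(1) assms(2)[of n] t] tf show ?thesis unfolding diff_0_right by linarith
  qed
  then show "\<exists>N. \<forall>n\<ge>N. norm (ip f (g n) - 0) < r" by blast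
qed

section \<open>Orthogonality of distinct angular frequencies\<close>

text \<open>A rotation by \<open>c\<close> with \<open>c ^ m * cnj (c ^ n) = -1\<close> preserves
  the modulus and flips the sign of the integrand, so the integral equals its own negative.\<close>

lemma radial_orthogonal:
  assumes "F \<in> borel_measurable borel" and "m \<noteq> n"
  shows "(\<integral>z. of_real (F (cmod z)) * sgn z ^ m * cnj (sgn z ^ n) \<partial>\<nu>) = 0" (is "?I = 0")
proof -
  define f :: "complex \<Rightarrow> complex" where "f z = of_real (F (cmod z)) * sgn z ^ m * cnj (sgn z ^ n)" for z
  have sgn_m: "(\<lambda>z::complex. sgn z) \<in> borel_measurable borel"
    unfolding sgn_div_norm by measurable
  have cnj_m: "cnj \<in> borel_measurable borel"
    by (intro borel_measurable_continuous_onI continuous_intros)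
  have f: "f \<in> borel_measurable borel"
    unfolding f_def using sgn_m assms(1)
    by (intro borel_measurable_times measurable_compose[OF _ cnj_m] borel_measurable_power
         measurable_compose[OF _ borel_measurable_of_real] measurable_compose[OF borel_measurable_norm assms(1)])
        (auto intro: measurable_compose[OF _ assms(1)])
  \<comment> \<open>The difference is taken in the reals, so the same angle serves
    \<open>m < n\<close> and \<open>m > n\<close>.\<close>
  define c where "c = cis (pi / (real m - real n))"
  have "c ^ m * cnj (c ^ n) = cis (pi / (real m - real n) * (real m - real n))"
    by (simp add: c_def Complex.DeMoivre cis_cnj cis_mult diff_divide_distrib[symmetric] algebra_simps)
  also have "\<dots> = -1" using assms(2) by simp
  finally have c: "c ^ m * cnj (c ^ n) = -1" .
  have "cmod c = 1" by (simp add: c_def)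
  then have "sgn c = c" by (simp add: sgn_div_norm)
  have "f (c * z) = - f z" for z
  proof -
    have "f (c * z) = (c ^ m * cnj (c ^ n)) * f z"
      using \<open>cmod c = 1\<close> \<open>sgn c = c\<close>
      by (simp add: f_def norm_mult sgn_mult power_mult_distrib mult_ac)
    then show ?thesis unfolding c by simp
  qed
  then have "?I = - ?I" using rotation[OF \<open>cmod c = 1\<close> f] by (simp add: f_def)
  then show ?thesis by simp
qed

definition monomial_sqnorm :: "nat \<Rightarrow> real" where
  "monomial_sqnorm k = sqnorm (\<lambda>z. z ^ k)"

text \<open>In polar form the powers of the modulus join the radial factor, and only
  \<open>sgn z\<close> carries frequency. A general \<open>F\<close> admits the cut-offs to smaller
  discs in \<open>coef_power_series\<close>.\<close>

lemma power_orthogonal: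
  assumes "F \<in> borel_measurable borel" "m \<noteq> n"
  shows "(\<integral>z. of_real (F (cmod z)) * z ^ m * cnj (z ^ n) \<partial>\<nu>) = 0"
proof -
  have "of_real (F (cmod z)) * z ^ m * cnj (z ^ n)
      = of_real (F (cmod z) * cmod z ^ (m + n)) * sgn z ^ m * cnj (sgn z ^ n)" for z
  proof -
    have z: "z = of_real (cmod z) * sgn z"
      by (cases "z = 0") (simp_all add: sgn_div_norm scaleR_conv_of_real)
    have "z ^ m = of_real (cmod z ^ m) * sgn z ^ m" "cnj (z ^ n) = of_real (cmod z ^ n) * cnj (sgn z ^ n)"
      by (subst z, simp only: power_mult_distrib of_real_power complex_cnj_mult complex_cnj_power complex_cnj_complex_of_real)+
    then show ?thesis by (simp add: power_add mult_ac)
  qed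
  then show ?thesis
    using radial_orthogonal[of "\<lambda>r. F r * r ^ (m + n)" m n] assms
    by (simp del: of_real_mult of_real_power complex_cnj_power)
qed

lemma ip_power: "ip (\<lambda>z. z ^ m) (\<lambda>z. z ^ n) = (if m = n then of_real (monomial_sqnorm n) else 0)"
  using power_orthogonal[of "\<lambda>_. 1" m n] ip_self[of "\<lambda>z. z ^ n"] by (simp add: ip_def monomial_sqnorm_def)

text \<open>The set where a continuous \<open>f\<close> does not vanish is open. If nonempty, it has
  nonzero measure by \<open>open_pos\<close>, whereas a zero norm makes it null.\<close>

lemma sqnorm_eq_0D:
  assumes f: "f \<in> L2" "continuous_on (ball 0 1) f" and "sqnorm f = 0" and z: "z \<in> ball 0 1"
  shows "f z = 0"
proof (rule ccontr)
  assume "f z \<noteq> 0"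
  define U where "U = ball 0 1 \<inter> f -` (- {0})"
  have "open U" unfolding U_def by (intro continuous_open_preimage f) auto
  moreover have "U \<noteq> {}" "U \<subseteq> ball 0 1" using z \<open>f z \<noteq> 0\<close> by (auto simp: U_def)
  ultimately have "emeasure \<nu> U \<noteq> 0" by (rule open_pos)
  moreover have "AE z in \<nu>. (cmod (f z))\<^sup>2 = 0"
    using assms(3) integral_nonneg_eq_0_iff_AE[OF L2_integrable[OF f(1)]] by (simp add: sqnorm_def)
  then have "AE z in \<nu>. z \<notin> U"
    by eventually_elim (auto simp: U_def)
  moreover have "U \<in> sets \<nu>"
  proof -
    have "(\<lambda>z. z) -` U \<inter> space \<nu> \<in> sets \<nu>"
      using \<open>open U\<close> by (intro measurable_sets[OF measurable_id]) auto
    moreover have "(\<lambda>z. z) -` U \<inter> space \<nu> = U" by (auto simp: U_def space_eq)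
    ultimately show ?thesis by simp
  qed
  ultimately have "U \<in> null_sets \<nu>" by (subst AE_iff_null_sets) auto
  with \<open>emeasure \<nu> U \<noteq> 0\<close> show False by auto
qed

lemma monomial_sqnorm_pos: "monomial_sqnorm k > 0"
proof -
  have "monomial_sqnorm k \<noteq> 0"
  proof
    assume "monomial_sqnorm k = 0"
    then have "(1/2 :: complex) ^ k = 0"
      unfolding monomial_sqnorm_def by (intro sqnorm_eq_0D[OF L2_power]) (auto intro!: continuous_intros)
    then show False by simp
  qed
  then show ?thesis using sqnorm_nonneg[of "\<lambda>z. z ^ k"] by (simp add: monomial_sqnorm_def)
qed

section \<open>Lower bounds from the mass near the boundary\<close>

lemma annulus_pos:
  assumes "0 \<le> r" "r < 1"
  shows "measure \<nu> (ball 0 1 - cball 0 r) > 0"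
proof -
  have "open (ball (0::complex) 1 - cball 0 r)" by (intro open_Diff) auto
  moreover
  have "of_real ((r + 1) / 2) \<in> ball (0::complex) 1 - cball 0 r"
    using assms by (simp del: of_real_divide of_real_add add: norm_of_real)
  then have "ball (0::complex) 1 - cball 0 r \<noteq> {}" by (metis empty_iff)
  ultimately have "emeasure \<nu> (ball 0 1 - cball 0 r) \<noteq> 0"
    by (rule open_pos) (rule Diff_subset)
  then show ?thesis by (simp add: emeasure_eq_measure zero_less_measure_iff)
qed

lemma annulus_sets: "ball 0 1 - cball 0 r \<in> sets \<nu>"
proof -
  have "(\<lambda>z. z) -` (ball 0 1 - cball 0 r) \<inter> space \<nu> \<in> sets \<nu>"
    by (intro measurable_sets[OF measurable_id]) auto
  moreover have "(\<lambda>z. z) -` (ball 0 1 - cball 0 r) \<inter> space \<nu> = ball 0 1 - cball 0 r"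
    by (auto simp: space_eq)
  ultimately show ?thesis by simp
qed

text \<open>Only the annulus outside \<open>cball 0 r\<close> is kept, where monotonicity bounds the
  integrand below by \<open>F r\<close>. This serves integer powers and real exponents
  alike.\<close>

lemma radial_lower_bound:
  assumes r: "0 \<le> r" "r < 1" and F: "F \<in> borel_measurable borel"
    and nonneg: "\<And>t. \<lbrakk>0 \<le> t; t < 1\<rbrakk> \<Longrightarrow> 0 \<le> F t" and bd: "\<And>t. \<lbrakk>0 \<le> t; t < 1\<rbrakk> \<Longrightarrow> F t \<le> B"
    and mono: "\<And>t. \<lbrakk>r \<le> t; t < 1\<rbrakk> \<Longrightarrow> F r \<le> F t"
  shows "F r * measure \<nu> (ball 0 1 - cball 0 r) \<le> (\<integral>z. F (cmod z) \<partial>\<nu>)"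
proof -
  have "F r * measure \<nu> (ball 0 1 - cball 0 r) = (\<integral>z. F r * indicator (ball 0 1 - cball 0 r) z \<partial>\<nu>)"
    using annulus_sets[of r] by (simp add: space_eq Int_absorb2)
  also have "\<dots> \<le> (\<integral>z. F (cmod z) \<partial>\<nu>)"
  proof (rule integral_mono)
    show "integrable \<nu> (\<lambda>z. F (cmod z))"
      using nonneg bd by (intro integrable_bounded[where B=B] measurable_borel
          measurable_compose[OF _ F]) (auto intro!: borel_measurable_norm)
    show "integrable \<nu> (\<lambda>z. F r * indicator (ball 0 1 - cball 0 r) z)"
      using annulus_sets[of r] by (intro integrable_mult_right integrable_real_indicator) (auto simp: emeasure_eq_measure)
    show "F r * indicator (ball 0 1 - cball 0 r) z \<le> F (cmod z)" if "z \<in> space \<nu>" for z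
      using that nonneg mono by (auto simp: space_eq indicator_def)
  qed
  finally show ?thesis .
qed

lemma monomial_sqnorm_lower_bound:
  assumes "0 \<le> r" "r < 1"
  shows "r ^ (2 * k) * measure \<nu> (ball 0 1 - cball 0 r) \<le> monomial_sqnorm k"
proof -
  have "monomial_sqnorm k = (\<integral>z. cmod z ^ (2 * k) \<partial>\<nu>)"
    by (simp add: monomial_sqnorm_def sqnorm_def norm_power power_mult[symmetric] mult.commute)
  then show ?thesis
    using assms
    by (auto intro!: radial_lower_bound[OF assms, of "\<lambda>t. t ^ (2 * k)" 1] power_le_one power_mono)
qed

lemma L2_poly: "(\<lambda>z. \<Sum>k\<in>I. a k * z ^ k) \<in> L2"
  by (intro L2_sum L2_scale L2_power)

lemma ip_poly:
  assumes "f \<in> L2"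
  shows "ip f (\<lambda>z. \<Sum>k\<in>I. a k * z ^ k) = (\<Sum>k\<in>I. cnj (a k) * ip f (\<lambda>z. z ^ k))"
  using assms by (subst ip_sum_right) (auto simp: ip_scale_right intro: L2_scale L2_power)

lemma ip_poly_power:
  assumes "finite I"
  shows "ip (\<lambda>z. \<Sum>k\<in>I. a k * z ^ k) (\<lambda>z. z ^ n) = (if n \<in> I then a n * of_real (monomial_sqnorm n) else 0)"
proof -
  have "ip (\<lambda>z. \<Sum>k\<in>I. a k * z ^ k) (\<lambda>z. z ^ n) = (\<Sum>k\<in>I. if k = n then a n * of_real (monomial_sqnorm n) else 0)"
    by (subst ip_sum_left) (auto simp: ip_scale_left ip_power intro: L2_scale L2_power intro!: sum.cong)
  then show ?thesis using assms by simp
qed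

lemma sqnorm_poly:
  assumes "finite I"
  shows "sqnorm (\<lambda>z. \<Sum>k\<in>I. a k * z ^ k) = (\<Sum>k\<in>I. (cmod (a k))\<^sup>2 * monomial_sqnorm k)"
proof -
  have "complex_of_real (sqnorm (\<lambda>z. \<Sum>k\<in>I. a k * z ^ k)) = (\<Sum>k\<in>I. cnj (a k) * (a k * of_real (monomial_sqnorm k)))"
    using assms by (subst ip_self[symmetric], subst ip_poly[OF L2_poly]) (simp add: ip_poly_power)
  also have "\<dots> = of_real (\<Sum>k\<in>I. (cmod (a k))\<^sup>2 * monomial_sqnorm k)"
    unfolding of_real_sum of_real_mult complex_norm_square by (simp add: mult_ac)
  finally show ?thesis by (simp only: of_real_eq_iff)
qed

section \<open>Fourier coefficients and power series\<close>

text \<open>The monomials are left unnormalised, so that for functions in \<open>A2\<close> these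
  are the Taylor coefficients at the origin.\<close>

definition coef :: "(complex \<Rightarrow> complex) \<Rightarrow> nat \<Rightarrow> complex" where
  "coef f k = ip f (\<lambda>z. z ^ k) / of_real (monomial_sqnorm k)"

lemma ip_eq_coef: "ip f (\<lambda>z. z ^ k) = coef f k * of_real (monomial_sqnorm k)"
  using monomial_sqnorm_pos[of k] by (simp add: coef_def)

text \<open>The difference of \<open>f\<close> and its partial Fourier sum has nonnegative square
  norm; expanding it leaves \<open>sqnorm f\<close> minus the sum.\<close>

lemma bessel:
  assumes "f \<in> L2"
  shows "(\<Sum>k<N. (cmod (coef f k))\<^sup>2 * monomial_sqnorm k) \<le> sqnorm f"
proof -
  let ?s = "\<lambda>z. \<Sum>k<N. coef f k * z ^ k" and ?S = "\<Sum>k<N. (cmod (coef f k))\<^sup>2 * monomial_sqnorm k"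
  have "ip f ?s = (\<Sum>k<N. cnj (coef f k) * (coef f k * of_real (monomial_sqnorm k)))"
    using assms by (simp add: ip_poly ip_eq_coef)
  also have "\<dots> = of_real ?S"
    unfolding of_real_sum of_real_mult complex_norm_square by (simp add: mult_ac)
  finally have "ip f ?s = of_real ?S" .
  then have "sqnorm (\<lambda>z. f z - ?s z) = sqnorm f - 2 * ?S + ?S"
    by (subst sqnorm_diff[OF assms L2_poly]) (simp add: sqnorm_poly)
  with sqnorm_nonneg[of "\<lambda>z. f z - ?s z"] show ?thesis by simp
qed

lemma bessel_summable: "f \<in> L2 \<Longrightarrow> summable (\<lambda>k. (cmod (coef f k))\<^sup>2 * monomial_sqnorm k)"
  by (rule summableI_nonneg_bounded[where x="sqnorm f"]) (auto simp: bessel less_imp_le[OF monomial_sqnorm_pos])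

text \<open>By orthogonality the square norm of a block of the series is a block of the scalar
  series. Fatou's lemma, applied to the pointwise convergence of the partial sums, turns this into a
  bound of the remainder by the scalar tail.\<close>

lemma power_series_L2:
  assumes sm: "summable (\<lambda>k. (cmod (a k))\<^sup>2 * monomial_sqnorm k)"
    and h: "\<And>z. z \<in> ball 0 1 \<Longrightarrow> (\<lambda>k. a k * z ^ k) sums h z"
  shows "h \<in> L2" and "(\<lambda>N. sqnorm (\<lambda>z. h z - (\<Sum>k<N. a k * z ^ k))) \<longlonglongrightarrow> 0"
proof -
  define b where "b k = (cmod (a k))\<^sup>2 * monomial_sqnorm k" for k
  have b: "b k \<ge> 0" for k using monomial_sqnorm_pos[of k] by (simp add: b_def)
  define s where "s N z = (\<Sum>k<N. a k * z ^ k)" for N z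
  have s_L2: "s N \<in> L2" for N unfolding s_def by (rule L2_poly)
  have "h holomorphic_on ball 0 1"
    by (rule power_series_holomorphic[where a=a]) (use h in auto)
  then have h_meas: "h \<in> borel_measurable \<nu>"
    by (intro measurable_continuous_on holomorphic_on_imp_continuous_on)
  have tail: "(\<integral>\<^sup>+z. ennreal ((cmod (h z - s N z))\<^sup>2) \<partial>\<nu>) \<le> ennreal (\<Sum>k. b (k + N))" for N
  proof -
    have "(\<integral>\<^sup>+z. ennreal ((cmod (h z - s N z))\<^sup>2) \<partial>\<nu>)
        = (\<integral>\<^sup>+z. liminf (\<lambda>M. ennreal ((cmod (s M z - s N z))\<^sup>2)) \<partial>\<nu>)"
    proof (rule nn_integral_cong)
      fix z assume "z \<in> space \<nu>"
      then have "(\<lambda>M. s M z) \<longlonglongrightarrow> h z" using h by (auto simp: space_eq sums_def s_def)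
      then have "(\<lambda>M. ennreal ((cmod (s M z - s N z))\<^sup>2)) \<longlonglongrightarrow> ennreal ((cmod (h z - s N z))\<^sup>2)"
        by (intro tendsto_intros)
      then show "ennreal ((cmod (h z - s N z))\<^sup>2) = liminf (\<lambda>M. ennreal ((cmod (s M z - s N z))\<^sup>2))"
        by (intro lim_imp_Liminf[symmetric]) auto
    qed
    also have "\<dots> \<le> liminf (\<lambda>M. \<integral>\<^sup>+z. ennreal ((cmod (s M z - s N z))\<^sup>2) \<partial>\<nu>)"
      by (intro nn_integral_liminf) (use s_L2[THEN L2_measurable] in measurable)
    also have "\<dots> \<le> ennreal (\<Sum>k. b (k + N))"
    proof (rule Liminf_le)
      show "\<forall>\<^sub>F M in sequentially. (\<integral>\<^sup>+z. ennreal ((cmod (s M z - s N z))\<^sup>2) \<partial>\<nu>) \<le> ennreal (\<Sum>k. b (k + N))"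
        using eventually_ge_at_top[of N]
      proof eventually_elim
        case (elim M)
        have eq: "s M z - s N z = (\<Sum>k\<in>{N..<M}. a k * z ^ k)" for z
          unfolding s_def lessThan_atLeast0 using sum_diff_nat_ivl[of 0 N M "\<lambda>k. a k * z ^ k"] elim by simp
        have "(\<integral>\<^sup>+z. ennreal ((cmod (s M z - s N z))\<^sup>2) \<partial>\<nu>) = ennreal (sqnorm (\<lambda>z. s M z - s N z))"
          unfolding sqnorm_def by (intro nn_integral_eq_integral L2_integrable L2_diff s_L2) auto
        also have "sqnorm (\<lambda>z. s M z - s N z) = (\<Sum>k\<in>{N..<M}. b k)"
          unfolding eq b_def by (rule sqnorm_poly) simp
        also have "\<dots> = (\<Sum>k<M - N. b (k + N))"
          using elim by (intro sum.reindex_bij_witness[of _ "\<lambda>k. k + N" "\<lambda>k. k - N"]) auto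
        also have "\<dots> \<le> (\<Sum>k. b (k + N))"
          using sm b by (intro sum_le_suminf summable_ignore_initial_segment) (auto simp: b_def)
        finally show ?case by (simp add: ennreal_leI)
      qed
    qed simp
    finally show ?thesis .
  qed
  have diff_L2: "(\<lambda>z. h z - s N z) \<in> L2" for N
  proof -
    have "integrable \<nu> (\<lambda>z. (cmod (h z - s N z))\<^sup>2)"
    proof (rule integrableI_bounded)
      show "(\<lambda>z. (cmod (h z - s N z))\<^sup>2) \<in> borel_measurable \<nu>"
        using h_meas s_L2[THEN L2_measurable] by measurable
      have "(\<integral>\<^sup>+z. ennreal (norm ((cmod (h z - s N z))\<^sup>2)) \<partial>\<nu>) \<le> ennreal (\<Sum>k. b (k + N))"
        using tail[of N] by simp
      then show "(\<integral>\<^sup>+z. ennreal (norm ((cmod (h z - s N z))\<^sup>2)) \<partial>\<nu>) < \<infinity>"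
        by (rule le_less_trans) simp
    qed
    then show ?thesis using h_meas s_L2[THEN L2_measurable] by (simp add: L2_def)
  qed
  \<comment> \<open>The partial sum \<open>s 0\<close> is empty, so the remainder with
    \<open>N = 0\<close> is \<open>h\<close> itself.\<close>
  show "h \<in> L2" using diff_L2[of 0] by (simp add: s_def)
  have le: "sqnorm (\<lambda>z. h z - s N z) \<le> (\<Sum>k. b (k + N))" for N
  proof -
    have "ennreal (sqnorm (\<lambda>z. h z - s N z)) \<le> ennreal (\<Sum>k. b (k + N))"
      using tail[of N] unfolding sqnorm_def
      by (subst nn_integral_eq_integral[symmetric]) (auto intro!: L2_integrable diff_L2)
    then show ?thesis
      using sm b by (subst (asm) ennreal_le_iff) (auto intro!: suminf_nonneg summable_ignore_initial_segment simp: b_def)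
  qed
  have "(\<lambda>N. \<Sum>k. b (k + N)) \<longlonglongrightarrow> 0"
    using suminf_exist_split2[of b] sm unfolding b_def by simp
  then have "(\<lambda>N. sqnorm (\<lambda>z. h z - s N z)) \<longlonglongrightarrow> 0"
    by (rule tendsto_sandwich[OF _ _ tendsto_const, rotated 2]) (auto simp: le sqnorm_nonneg)
  then show "(\<lambda>N. sqnorm (\<lambda>z. h z - (\<Sum>k<N. a k * z ^ k))) \<longlonglongrightarrow> 0"
    by (simp add: s_def)
qed

lemma bounded_coeff_summable:
  assumes r: "0 < r" and bd: "\<And>k. cmod (a k) * r ^ k \<le> B" and z: "cmod z < r"
  shows "summable (\<lambda>k. a k * z ^ k)"
proof (rule summable_comparison_test')
  show "summable (\<lambda>k. B * (cmod z / r) ^ k)"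
    using r z by (intro summable_mult summable_geometric) auto
  show "norm (a k * z ^ k) \<le> B * (cmod z / r) ^ k" for k
  proof -
    have "norm (a k * z ^ k) = (cmod (a k) * r ^ k) * (cmod z / r) ^ k"
      using r by (simp add: norm_mult norm_power power_divide)
    also have "\<dots> \<le> B * (cmod z / r) ^ k" using r by (intro mult_right_mono bd) auto
    finally show ?thesis .
  qed
qed

text \<open>Since \<open>monomial_sqnorm k\<close> is at least a positive multiple of
  \<open>r ^ (2 * k)\<close>, Bessel's inequality bounds the coefficients at radius
  \<open>r\<close>; taking \<open>r\<close> between \<open>cmod z\<close> and 1 gives a geometric
  majorant.\<close>

lemma coef_series_summable:
  assumes f: "f \<in> L2" and z: "z \<in> ball 0 1"
  shows "summable (\<lambda>k. coef f k * z ^ k)"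
proof -
  define r where "r = (cmod z + 1) / 2"
  have r: "0 < r" "r < 1" "cmod z < r" using z by (auto simp: r_def add_nonneg_pos)
  define C where "C = measure \<nu> (ball 0 1 - cball 0 r)"
  have C: "C > 0" unfolding C_def using r by (intro annulus_pos) auto
  have "cmod (coef f k) * r ^ k \<le> sqrt (sqnorm f / C)" for k
  proof (rule real_le_rsqrt)
    have "(cmod (coef f k))\<^sup>2 * (r ^ (2 * k) * C) \<le> (cmod (coef f k))\<^sup>2 * monomial_sqnorm k"
      using r monomial_sqnorm_lower_bound[of r k] by (intro mult_left_mono) (auto simp: C_def)
    also have "\<dots> \<le> (\<Sum>j<Suc k. (cmod (coef f j))\<^sup>2 * monomial_sqnorm j)"
      by (rule member_le_sum) (auto simp: less_imp_le[OF monomial_sqnorm_pos])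
    also have "\<dots> \<le> sqnorm f" by (rule bessel[OF f])
    finally show "(cmod (coef f k) * r ^ k)\<^sup>2 \<le> sqnorm f / C"
      using C by (simp add: pos_le_divide_eq power_mult_distrib power_mult[symmetric] mult_ac)
  qed
  then show ?thesis using r by (intro bounded_coeff_summable[of r])
qed

lemma limit_at_one_seq: "(\<lambda>n. 1 - 1 / real (Suc n)) \<longlonglongrightarrow> 1"
  using tendsto_diff[OF tendsto_const LIMSEQ_inverse_real_of_nat, of 1] by (simp add: inverse_eq_divide)

text \<open>The partial sums have a constant majorant on each smaller disc. Cutting off at radius
  \<open>R\<close> is a radial factor, which keeps orthogonality and yields
  \<open>I R = a n * J R\<close>; dominated convergence with \<open>h\<close> in \<open>L2\<close>
  then lets \<open>R\<close> tend to 1.\<close>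

lemma coef_power_series:
  assumes h: "h \<in> L2" and sums: "\<And>z. z \<in> ball 0 1 \<Longrightarrow> (\<lambda>k. a k * z ^ k) sums h z"
  shows "coef h n = a n"
proof -
  let ?ind = "\<lambda>R z. indicator (ball 0 R) z :: complex"
  have ind: "?ind R z = of_real (indicator {..<R} (cmod z))" for R z
    by (auto simp: indicator_def)
  have ind_meas: "(\<lambda>z. ?ind R z) \<in> borel_measurable \<nu>" for R
    by (intro measurable_borel borel_measurable_indicator borel_open open_ball)
  define I J where "I R = (\<integral>z. ?ind R z * h z * cnj (z ^ n) \<partial>\<nu>)"
    and "J R = (\<integral>z. ?ind R z * z ^ n * cnj (z ^ n) \<partial>\<nu>)" for R
  have hm: "h \<in> borel_measurable \<nu>" using h by (rule L2_measurable)
  have pm: "(\<lambda>z. z ^ k) \<in> borel_measurable \<nu>" "(\<lambda>z. cnj (z ^ k)) \<in> borel_measurable \<nu>" for k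
    by (auto intro!: measurable_continuous_on continuous_intros)
  have IJ: "I R = a n * J R" if R: "0 < R" "R < 1" for R
  proof -
    define S where "S N = (\<integral>z. ?ind R z * (\<Sum>k<N. a k * z ^ k) * cnj (z ^ n) \<partial>\<nu>)" for N
    \<comment> \<open>Convergence at the larger radius \<open>(R + 1) / 2\<close> gives absolute
      convergence at \<open>R\<close>, hence the constant majorant.\<close>
    have "summable (\<lambda>k. norm (a k * of_real R ^ k))"
      using R by (intro powser_insidea[of a "of_real ((R + 1) / 2)"] sums_summable[OF sums])
        (auto simp del: of_real_divide of_real_add)
    then have sm: "summable (\<lambda>k. cmod (a k) * R ^ k)" using R by (simp add: norm_mult norm_power)
    have "S \<longlonglongrightarrow> I R"
      unfolding S_def I_def
    proof (rule integral_dominated_convergence[where w="\<lambda>_. \<Sum>k. cmod (a k) * R ^ k"])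
      show "(\<lambda>z. ?ind R z * h z * cnj (z ^ n)) \<in> borel_measurable \<nu>"
        by (intro borel_measurable_times ind_meas hm pm)
      show "(\<lambda>z. ?ind R z * (\<Sum>k<N. a k * z ^ k) * cnj (z ^ n)) \<in> borel_measurable \<nu>" for N
        by (intro borel_measurable_times borel_measurable_sum borel_measurable_const ind_meas hm pm)
      show "AE z in \<nu>. (\<lambda>N. ?ind R z * (\<Sum>k<N. a k * z ^ k) * cnj (z ^ n)) \<longlonglongrightarrow> ?ind R z * h z * cnj (z ^ n)"
        using sums by (intro AE_I2 tendsto_intros) (auto simp: sums_def space_eq)
      show "AE z in \<nu>. norm (?ind R z * (\<Sum>k<N. a k * z ^ k) * cnj (z ^ n)) \<le> (\<Sum>k. cmod (a k) * R ^ k)" for N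
      proof (intro AE_I2)
        fix z assume z: "z \<in> space \<nu>"
        have nn: "0 \<le> (\<Sum>k. cmod (a k) * R ^ k)" using sm R by (intro suminf_nonneg) auto
        show "norm (?ind R z * (\<Sum>k<N. a k * z ^ k) * cnj (z ^ n)) \<le> (\<Sum>k. cmod (a k) * R ^ k)"
        proof (cases "cmod z < R")
          case True
          have "norm (\<Sum>k<N. a k * z ^ k) \<le> (\<Sum>k<N. cmod (a k) * R ^ k)"
            using True by (intro sum_norm_le) (auto simp: norm_mult norm_power intro!: mult_left_mono power_mono)
          also have "\<dots> \<le> (\<Sum>k. cmod (a k) * R ^ k)"
            using sm R by (intro sum_le_suminf) auto
          finally have "norm (\<Sum>k<N. a k * z ^ k) * cmod z ^ n \<le> (\<Sum>k. cmod (a k) * R ^ k) * 1"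
            using z nn by (intro mult_mono power_le_one) (auto simp: space_eq)
          then show ?thesis using True by (simp add: norm_mult norm_power)
        qed (use nn in auto)
      qed
    qed simp
    \<comment> \<open>As soon as \<open>N > n\<close>, the partial sum contains the one term that
      survives orthogonality, so \<open>S N\<close> is constant from there on.\<close>
    moreover have "\<forall>\<^sub>F N in sequentially. S N = a n * J R"
      using eventually_gt_at_top[of n]
    proof eventually_elim
      case (elim N)
      have int: "integrable \<nu> (\<lambda>z. ?ind R z * z ^ k * cnj (z ^ n))" for k
      proof (rule integrable_bounded[where B=1])
        show "(\<lambda>z. ?ind R z * z ^ k * cnj (z ^ n)) \<in> borel_measurable \<nu>"
          by (intro borel_measurable_times ind_meas pm)
        show "norm (?ind R z * z ^ k * cnj (z ^ n)) \<le> 1" if "cmod z < 1" for z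
          using that power_le_one[of "cmod z" "k + n"]
          by (auto simp: norm_mult norm_power indicator_def power_add)
      qed
      have "S N = (\<integral>z. (\<Sum>k<N. a k * (?ind R z * z ^ k * cnj (z ^ n))) \<partial>\<nu>)"
        unfolding S_def by (simp add: sum_distrib_left sum_distrib_right mult_ac)
      also have "\<dots> = (\<Sum>k<N. a k * (\<integral>z. ?ind R z * z ^ k * cnj (z ^ n) \<partial>\<nu>))"
        using int by (subst Bochner_Integration.integral_sum) auto
      also have "\<dots> = (\<Sum>k<N. if k = n then a n * J R else 0)"
        unfolding J_def ind by (intro sum.cong) (auto simp: power_orthogonal simp del: complex_cnj_power)
      finally show ?case using elim by simp
    qed
    ultimately have "(\<lambda>N. a n * J R) \<longlonglongrightarrow> I R" by (rule Lim_transform_eventually)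
    then show ?thesis by (simp add: LIMSEQ_const_iff)
  qed
  have ind_lim: "(\<lambda>m. ?ind (1 - 1 / real (Suc m)) z) \<longlonglongrightarrow> 1" if "cmod z < 1" for z
  proof (rule tendsto_eventually)
    have "\<forall>\<^sub>F m in sequentially. cmod z < 1 - 1 / real (Suc m)"
      by (rule order_tendstoD(1)[OF limit_at_one_seq that])
    then show "\<forall>\<^sub>F m in sequentially. ?ind (1 - 1 / real (Suc m)) z = 1"
      by eventually_elim auto
  qed
  have lim: "(\<lambda>m. \<integral>z. ?ind (1 - 1 / real (Suc m)) z * f z * cnj (z ^ n) \<partial>\<nu>) \<longlonglongrightarrow> ip f (\<lambda>z. z ^ n)"
    if f: "f \<in> L2" for f
    unfolding ip_def
  proof (rule integral_dominated_convergence[where w="\<lambda>z. cmod (f z * cnj (z ^ n))"])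
    show "(\<lambda>z. f z * cnj (z ^ n)) \<in> borel_measurable \<nu>"
      "\<And>m. (\<lambda>z. ?ind (1 - 1 / real (Suc m)) z * f z * cnj (z ^ n)) \<in> borel_measurable \<nu>"
      by (intro borel_measurable_times ind_meas pm L2_measurable[OF f])+
    show "integrable \<nu> (\<lambda>z. cmod (f z * cnj (z ^ n)))"
      by (intro integrable_norm integrable_mult f L2_power)
    show "AE z in \<nu>. (\<lambda>m. ?ind (1 - 1 / real (Suc m)) z * f z * cnj (z ^ n)) \<longlonglongrightarrow> f z * cnj (z ^ n)"
    proof (intro AE_I2)
      fix z assume "z \<in> space \<nu>"
      then have "(\<lambda>m. ?ind (1 - 1 / real (Suc m)) z * f z * cnj (z ^ n)) \<longlonglongrightarrow> 1 * f z * cnj (z ^ n)"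
        by (intro tendsto_intros ind_lim) (auto simp: space_eq)
      then show "(\<lambda>m. ?ind (1 - 1 / real (Suc m)) z * f z * cnj (z ^ n)) \<longlonglongrightarrow> f z * cnj (z ^ n)" by simp
    qed
    show "AE z in \<nu>. norm (?ind (1 - 1 / real (Suc m)) z * f z * cnj (z ^ n)) \<le> cmod (f z * cnj (z ^ n))" for m
      by (intro AE_I2) (auto simp: indicator_def)
  qed
  have I: "(\<lambda>m. I (1 - 1 / real (Suc m))) \<longlonglongrightarrow> ip h (\<lambda>z. z ^ n)"
    unfolding I_def by (rule lim[OF h])
  have J: "(\<lambda>m. a n * J (1 - 1 / real (Suc m))) \<longlonglongrightarrow> a n * ip (\<lambda>z. z ^ n) (\<lambda>z. z ^ n)"
    unfolding J_def by (intro tendsto_intros lim L2_power)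
  \<comment> \<open>The index \<open>m = 0\<close> gives the radius 0, which \<open>IJ\<close>
    excludes.\<close>
  have "\<forall>\<^sub>F m in sequentially. a n * J (1 - 1 / real (Suc m)) = I (1 - 1 / real (Suc m))"
    using eventually_gt_at_top[of 0] by eventually_elim (subst IJ, auto)
  from LIMSEQ_unique[OF Lim_transform_eventually[OF J this] I]
  have "a n * ip (\<lambda>z. z ^ n) (\<lambda>z. z ^ n) = ip h (\<lambda>z. z ^ n)" .
  then show ?thesis using monomial_sqnorm_pos[of n] by (simp add: coef_def ip_power field_simps)
qed

text \<open>Taylor expansion gives a power series, \<open>coef_power_series\<close> identifies its
  coefficients, and Bessel's inequality makes it converge in norm. Hence polynomials are dense in
  \<open>A2\<close>.\<close>

lemma A2_coef:
  assumes "h \<in> A2"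
  shows "z \<in> ball 0 1 \<Longrightarrow> (\<lambda>k. coef h k * z ^ k) sums h z"
    and "(\<lambda>N. sqnorm (\<lambda>z. h z - (\<Sum>k<N. coef h k * z ^ k))) \<longlonglongrightarrow> 0"
proof -
  define a where "a k = (deriv ^^ k) h 0 / fact k" for k
  have hol: "h holomorphic_on ball 0 1" and h: "h \<in> L2" using assms by (auto simp: A2_def)
  have sums: "(\<lambda>k. a k * z ^ k) sums h z" if "z \<in> ball 0 1" for z
    using holomorphic_power_series[OF hol that] by (simp add: a_def)
  have "coef h = a" using coef_power_series[OF h sums] by auto
  then show *: "(\<lambda>k. coef h k * z ^ k) sums h z" if "z \<in> ball 0 1" for z using sums[OF that] by simp
  show "(\<lambda>N. sqnorm (\<lambda>z. h z - (\<Sum>k<N. coef h k * z ^ k))) \<longlonglongrightarrow> 0"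
    by (rule power_series_L2(2)[OF bessel_summable[OF h] *])
qed

section \<open>Existence, uniqueness and contractivity of the projection\<close>

text \<open>Orthogonality to monomials passes to norm limits of polynomials, which by
  \<open>A2_coef\<close> exhaust \<open>A2\<close>.\<close>

lemma orthogonal_A2:
  assumes u: "u \<in> L2" and orth: "\<And>k. ip u (\<lambda>z. z ^ k) = 0" and h: "h \<in> A2"
  shows "ip u h = 0"
proof -
  have "(\<lambda>N. ip u (\<lambda>z. h z - (\<Sum>k<N. coef h k * z ^ k))) \<longlonglongrightarrow> 0"
    by (intro ip_tendsto_zero u L2_diff L2_poly A2_L2[OF h] A2_coef(2)[OF h])
  moreover have "ip u (\<lambda>z. h z - (\<Sum>k<N. coef h k * z ^ k)) = ip u h" for N
    using u h by (subst ip_diff_right) (auto simp: A2_L2 L2_poly ip_poly orth)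
  ultimately show ?thesis by (simp add: LIMSEQ_const_iff)
qed

text \<open>The projection is the power series with the Fourier coefficients of \<open>f\<close>.
  Bessel's inequality puts it in \<open>A2\<close>, and it has the same inner products with all
  monomials as \<open>f\<close>. Extension by 0 matches the normalisation in
  \<open>bergman_projection\<close>.\<close>

lemma projection_exists:
  assumes f: "f \<in> L2"
  obtains g where "g \<in> A2" "\<And>z. z \<notin> ball 0 1 \<Longrightarrow> g z = 0"
    "\<And>h. h \<in> A2 \<Longrightarrow> ip (\<lambda>z. f z - g z) h = 0"
proof
  define g where "g z = (if z \<in> ball 0 1 then \<Sum>k. coef f k * z ^ k else 0)" for z
  have sums: "(\<lambda>k. coef f k * z ^ k) sums g z" if "z \<in> ball 0 1" for z
    using summable_sums[OF coef_series_summable[OF f that]] that by (simp add: g_def)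
  have "g holomorphic_on ball 0 1"
    by (rule power_series_holomorphic[where a="coef f"]) (use sums in auto)
  moreover have gL2: "g \<in> L2" by (rule power_series_L2(1)[OF bessel_summable[OF f] sums])
  ultimately show "g \<in> A2" by (simp add: A2_def)
  show "g z = 0" if "z \<notin> ball 0 1" for z using that by (simp add: g_def)
  have "ip g (\<lambda>z. z ^ k) = ip f (\<lambda>z. z ^ k)" for k
    using coef_power_series[OF gL2 sums, of k] by (simp add: ip_eq_coef)
  then show "ip (\<lambda>z. f z - g z) h = 0" if "h \<in> A2" for h
    by (intro orthogonal_A2[OF L2_diff[OF f gL2] _ that]) (simp add: ip_diff_left f gL2 L2_power)
qed

text \<open>The difference of two candidates is orthogonal to all of \<open>A2\<close>, in
  particular to itself; continuity then makes it vanish at every point of the disc.\<close>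

lemma projection_unique:
  assumes g: "g \<in> A2" "\<And>h. h \<in> A2 \<Longrightarrow> ip (\<lambda>z. f z - g z) h = 0"
    and g': "g' \<in> A2" "\<And>h. h \<in> A2 \<Longrightarrow> ip (\<lambda>z. f z - g' z) h = 0"
    and f: "f \<in> L2" and z: "z \<in> ball 0 1"
  shows "g z = g' z"
proof -
  let ?d = "\<lambda>z. g z - g' z"
  have L2s: "g \<in> L2" "g' \<in> L2" using g(1) g'(1) by (auto simp: A2_L2)
  have hol: "?d holomorphic_on ball 0 1"
    using g(1) g'(1) by (intro holomorphic_on_diff) (simp_all add: A2_def)
  have d: "?d \<in> A2" using L2_diff[OF L2s] hol by (simp add: A2_def)
  have "ip (\<lambda>z. f z - g' z) ?d - ip (\<lambda>z. f z - g z) ?d = ip ?d ?d"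
    using L2s f A2_L2[OF d] by (simp add: ip_diff_left)
  then have "sqnorm ?d = 0" using g(2)[OF d] g'(2)[OF d] by (simp add: ip_self)
  moreover have "continuous_on (ball 0 1) ?d"
    using hol by (rule holomorphic_on_imp_continuous_on)
  ultimately show ?thesis using sqnorm_eq_0D[OF A2_L2[OF d] _ _ z] by simp
qed

lemma projection_contraction:
  assumes "f \<in> L2" "g \<in> A2" "\<And>h. h \<in> A2 \<Longrightarrow> ip (\<lambda>z. f z - g z) h = 0"
  shows "sqnorm g \<le> sqnorm f"
proof -
  have g: "g \<in> L2" using assms by (simp add: A2_L2)
  have "ip f g = ip g g" using assms(3)[OF assms(2)] assms(1) g by (simp add: ip_diff_left)
  then have "sqnorm (\<lambda>z. f z - g z) = sqnorm f - sqnorm g"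
    using assms(1) g by (simp add: sqnorm_diff ip_self)
  then show ?thesis using sqnorm_nonneg[of "\<lambda>z. f z - g z"] by simp
qed

text \<open>The function carries the single frequency \<open>n\<close>, so it is orthogonal to every
  other monomial; what remains is its coefficient at \<open>z ^ n\<close>.\<close>

lemma radial_projection:
  assumes F: "F \<in> borel_measurable borel" "\<And>t. \<lbrakk>0 \<le> t; t < 1\<rbrakk> \<Longrightarrow> \<bar>F t\<bar> \<le> B"
    and h: "h \<in> A2" and "n > 0"
  defines "f \<equiv> \<lambda>z. of_real (F (cmod z)) * sgn z ^ n"
  shows "ip (\<lambda>z. f z - of_real ((\<integral>z. F (cmod z) * cmod z ^ n \<partial>\<nu>) / monomial_sqnorm n) * z ^ n) h = 0"
proof -
  have "f \<in> L2"
  proof (rule bounded_L2)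
    have "(\<lambda>z::complex. sgn z) \<in> borel_measurable borel"
      unfolding sgn_div_norm by measurable
    moreover have "(\<lambda>z. complex_of_real (F (cmod z))) \<in> borel_measurable borel"
      by (intro measurable_compose[OF _ borel_measurable_of_real] measurable_compose[OF _ F(1)]) auto
    ultimately have "f \<in> borel_measurable borel"
      unfolding f_def by (intro borel_measurable_times borel_measurable_power)
    then show "f \<in> borel_measurable \<nu>" by (rule measurable_borel)
    show "cmod (f z) \<le> B" if "cmod z < 1" for z
      using F(2)[of "cmod z"] that \<open>n > 0\<close>
      by (cases "z = 0") (auto simp: f_def norm_mult norm_power norm_sgn zero_power)
  qed
  show ?thesis
  proof (rule orthogonal_A2[OF _ _ h])
    show "(\<lambda>z. f z - of_real ((\<integral>z. F (cmod z) * cmod z ^ n \<partial>\<nu>) / monomial_sqnorm n) * z ^ n) \<in> L2"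
      by (intro L2_diff L2_scale L2_power \<open>f \<in> L2\<close>)
    fix k
    have "ip f (\<lambda>z. z ^ k) = (if k = n then of_real (\<integral>z. F (cmod z) * cmod z ^ n \<partial>\<nu>) else 0)"
    proof -
      have eq: "f z * cnj (z ^ k) = of_real (F (cmod z) * cmod z ^ k) * sgn z ^ n * cnj (sgn z ^ k)" for z
      proof -
        have z: "z = of_real (cmod z) * sgn z"
          by (cases "z = 0") (simp_all add: sgn_div_norm scaleR_conv_of_real)
        have "cnj (z ^ k) = of_real (cmod z ^ k) * cnj (sgn z ^ k)"
          by (subst z, simp only: power_mult_distrib of_real_power complex_cnj_mult complex_cnj_power complex_cnj_complex_of_real)
        then show ?thesis by (simp add: f_def mult_ac)
      qed
      show ?thesis
      proof (cases "k = n")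
        case True
        \<comment> \<open>Off the origin \<open>sgn z\<close> has modulus 1; at the origin both
          sides vanish because \<open>n > 0\<close>.\<close>
        have "of_real (F (cmod z) * cmod z ^ n) * sgn z ^ n * cnj (sgn z ^ n) = complex_of_real (F (cmod z) * cmod z ^ n)" for z
        proof (cases "z = 0")
          case False
          have "sgn z ^ n * cnj (sgn z ^ n) = of_real ((cmod (sgn z ^ n))\<^sup>2)" by (rule complex_norm_square[symmetric])
          also have "\<dots> = 1" using False by (simp add: norm_power norm_sgn)
          finally show ?thesis by (simp only: mult.assoc mult_1_right)
        qed (use \<open>n > 0\<close> in auto)
        then have "ip f (\<lambda>z. z ^ n) = (\<integral>z. complex_of_real (F (cmod z) * cmod z ^ n) \<partial>\<nu>)"
          unfolding ip_def using eq True by (intro Bochner_Integration.integral_cong) (simp_all only:)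
        then show ?thesis using True by (simp only: if_True simp_thms integral_complex_of_real)
      next
        case False
        have "ip f (\<lambda>z. z ^ k) = (\<integral>z. of_real (F (cmod z) * cmod z ^ k) * sgn z ^ n * cnj (sgn z ^ k) \<partial>\<nu>)"
          unfolding ip_def by (intro Bochner_Integration.integral_cong eq refl)
        also have "\<dots> = 0"
          using F(1) False by (intro radial_orthogonal[of "\<lambda>t. F t * t ^ k"]) auto
        finally show ?thesis using False by simp
      qed
    qed
    then show "ip (\<lambda>z. f z - of_real ((\<integral>z. F (cmod z) * cmod z ^ n \<partial>\<nu>) / monomial_sqnorm n) * z ^ n) (\<lambda>z. z ^ k) = 0"
      using monomial_sqnorm_pos[of n]
      by (subst ip_diff_left[OF \<open>f \<in> L2\<close> L2_scale[OF L2_power] L2_power], subst ip_scale_left)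
         (simp add: ip_power)
  qed
qed

end

section \<open>Decay of convex functions with an almost reversed convexity inequality\<close>

text \<open>Both slopes are compared with the slope of the chord from \<open>a\<close> to
  \<open>d\<close>.\<close>

lemma convex_on_slope_mono:
  fixes f :: "real \<Rightarrow> real"
  assumes f: "convex_on I f" and I: "a \<in> I" "b \<in> I" "c \<in> I" "d \<in> I"
    and ord: "a < b" "c < d" "a \<le> c" "b \<le> d"
  shows "(f a - f b) / (a - b) \<le> (f c - f d) / (c - d)"
proof -
  have "(f a - f b) / (a - b) \<le> (f a - f d) / (a - d)"
    using convex_on_slope_le(1)[OF f I(1,4), of b] ord by (cases "b = d") auto
  also have "\<dots> \<le> (f c - f d) / (c - d)"
    using convex_on_slope_le(2)[OF f I(1,4), of c] ord by (cases "a = c") auto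
  finally show ?thesis .
qed

text \<open>Iterating the step gives indices growing at least geometrically along which
  \<open>u\<close> never falls below \<open>u n\<close>. Since \<open>u\<close> tends to 0, a
  positive \<open>u n\<close> is impossible.\<close>

lemma geometric_ascent_nonpos:
  fixes u :: "nat \<Rightarrow> real"
  assumes "\<sigma> > 1" and u: "u \<longlonglongrightarrow> 0" and n1: "n1 > 0"
    and step: "\<And>n. n \<ge> n1 \<Longrightarrow> \<exists>m. real m \<ge> \<sigma> * real n \<and> u n \<le> u m"
    and n: "n \<ge> n1"
  shows "u n \<le> 0"
proof (rule ccontr)
  assume "\<not> u n \<le> 0"
  then have "\<forall>\<^sub>F m in sequentially. u m < u n" using order_tendstoD(2)[OF u] by simp
  then obtain N where N: "\<And>m. m \<ge> N \<Longrightarrow> u m < u n" by (auto simp: eventually_sequentially)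
  have *: "\<exists>m. real m \<ge> \<sigma> ^ k * real n \<and> u n \<le> u m" for k
  proof (induction k)
    case (Suc k)
    then obtain m where m: "real m \<ge> \<sigma> ^ k * real n" "u n \<le> u m" by blast
    have "1 * real n \<le> \<sigma> ^ k * real n" using \<open>\<sigma> > 1\<close> by (intro mult_right_mono one_le_power) auto
    with m n have "m \<ge> n1" by simp
    then obtain m' where m': "real m' \<ge> \<sigma> * real m" "u m \<le> u m'" using step by blast
    have "\<sigma> * (\<sigma> ^ k * real n) \<le> \<sigma> * real m" using m \<open>\<sigma> > 1\<close> by (intro mult_left_mono) auto
    with m m' show ?case by (intro exI[of _ m']) (auto simp: mult.assoc)
  qed (auto intro: exI[of _ n])
  obtain k where "real N < \<sigma> ^ k" using real_arch_pow[OF \<open>\<sigma> > 1\<close>] by blast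
  also have "\<sigma> ^ k * 1 \<le> \<sigma> ^ k * real n" using \<open>\<sigma> > 1\<close> n n1 by (intro mult_left_mono) auto
  finally have k: "real N < \<sigma> ^ k * real n" by simp
  obtain m where "real m \<ge> \<sigma> ^ k * real n" "u n \<le> u m" using * by blast
  with k N[of m] show False by simp
qed

text \<open>Let \<open>s n\<close> and \<open>t n\<close> be the negated slopes of the chords over
  \<open>[A n, 2 n]\<close> and \<open>[2 n, B n]\<close>. Hypothesis \<open>C\<close> says that
  \<open>s n\<close> exceeds \<open>t n\<close> by at most a multiple of \<open>1 / n\<close>, and
  convexity bounds \<open>t n\<close> by \<open>s m\<close> for \<open>m\<close> close to a fixed
  multiple of \<open>n\<close>. Since \<open>s\<close> tends to 0, summing over geometric scales
  gives \<open>s n \<le> G / n\<close> for large \<open>n\<close>, which bounds the drop of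
  \<open>f\<close>.\<close>

lemma decreasing_convex_drop_bound:
  fixes f :: "real \<Rightarrow> real" and A B :: real
  assumes conv: "convex_on {0<..} f" and anti: "\<And>x y. \<lbrakk>0 < x; x \<le> y\<rbrakk> \<Longrightarrow> f y \<le> f x"
    and sublin: "\<And>e. e > 0 \<Longrightarrow> \<exists>c. \<forall>x>0. f x \<ge> c - e * x"
    and AB: "0 < A" "A < 2" "2 < B" and ab: "0 < a" "0 < b" "a + b = 1" "a * A + b * B = 2"
    and C: "\<And>n. n > (0::nat) \<Longrightarrow> a * f (A * n) + b * f (B * n) \<le> f (2 * real n) + C"
  obtains D where "D \<ge> 0" "\<And>n. n > (0::nat) \<Longrightarrow> f (A * n) \<le> f (2 * real n) + D"
proof -
  define s t where "s n = (f (A * n) - f (2 * real n)) / ((2 - A) * n)"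
    and "t n = (f (2 * real n) - f (B * n)) / ((B - 2) * n)" for n :: nat
  \<comment> \<open>Since 2 is the mean of \<open>A\<close> and \<open>B\<close> with weights
    \<open>a\<close> and \<open>b\<close>, this equals \<open>b * (B - 2)\<close>: both slopes enter
    hypothesis \<open>C\<close> with the same factor.\<close>
  define k where "k = a * (2 - A)"
  have "k = a * 2 - a * A" by (simp add: k_def algebra_simps)
  also have "\<dots> = 2 * (1 - b) - (2 - b * B)" using ab(3,4) by simp
  finally have kb: "k = b * (B - 2)" by (simp add: algebra_simps)
  have "k > 0" using ab AB by (simp add: k_def)
  define E where "E = max 0 (C / k)"
  \<comment> \<open>The largest factor with \<open>A * \<rho> \<le> 2\<close> and
    \<open>2 * \<rho> \<le> B\<close>, so that \<open>[A \<rho> n, 2 \<rho> n]\<close> lies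
    endpointwise to the left of \<open>[2 n, B n]\<close>.\<close>
  define \<rho> where "\<rho> = min (2 / A) (B / 2)"
  have \<rho>: "\<rho> > 1" "A * \<rho> \<le> 2" "2 * \<rho> \<le> B" using AB by (auto simp: \<rho>_def min_def field_simps)
  \<comment> \<open>A factor between 1 and \<open>\<rho>\<close> leaves room for rounding
    \<open>\<rho> * n\<close> down to an integer.\<close>
  define \<sigma> where "\<sigma> = (1 + \<rho>) / 2"
  have \<sigma>: "\<sigma> > 1" "\<sigma> < \<rho>" using \<rho> by (auto simp: \<sigma>_def)
  \<comment> \<open>Solves \<open>G - G / \<sigma> = E\<close>: passing from \<open>n\<close> to
    \<open>\<sigma> * n\<close> lowers \<open>G / n\<close> by exactly the error
    \<open>E / n\<close>.\<close>
  define G where "G = E * \<sigma> / (\<sigma> - 1)"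
  have "G - G / \<sigma> = E * (\<sigma> - 1) / (\<sigma> - 1)"
    using \<sigma> by (simp add: G_def right_diff_distrib diff_divide_distrib)
  then have G: "G \<ge> 0" "G - G / \<sigma> = E" using \<sigma> by (auto simp: G_def E_def)
  \<comment> \<open>Beyond this index \<open>\<rho> * n - 1\<close> exceeds
    \<open>\<sigma> * n\<close>.\<close>
  obtain n0 :: nat where n0: "1 / (\<rho> - \<sigma>) < n0" using reals_Archimedean2 by blast
  define n1 where "n1 = Suc n0"
  have s_nonneg: "s n \<ge> 0" if "n > 0" for n
    using that AB anti[of "A * n" "2 * real n"] by (simp add: s_def)
  have step: "\<exists>m. real m \<ge> \<sigma> * real n \<and> s n - G / n \<le> s m - G / m" if "n \<ge> n1" for n
  proof -
    have n: "n > 0" using that by (simp add: n1_def)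
    have "k * n * (s n - t n) = a * ((2 - A) * n * s n) - b * ((B - 2) * n * t n)"
      by (subst right_diff_distrib, subst (2) kb) (simp add: k_def mult_ac)
    also have "\<dots> = a * (f (A * n) - f (2 * real n)) - b * (f (2 * real n) - f (B * n))"
      using n AB by (simp add: s_def t_def)
    also have "\<dots> = a * f (A * n) + b * f (B * n) - (a + b) * f (2 * real n)" by (simp add: algebra_simps)
    also have "\<dots> \<le> C" using C[OF n] ab by simp
    finally have "k * n * (s n - t n) \<le> C" .
    then have "s n - t n \<le> C / (k * n)" using \<open>k > 0\<close> n by (simp add: field_simps)
    also have "C / (k * n) = (C / k) / n" by simp
    also have "\<dots> \<le> E / n" using n by (intro divide_right_mono) (auto simp: E_def)
    finally have 1: "s n - t n \<le> E / n" .
    \<comment> \<open>The interval \<open>[A m, 2 m]\<close> lies below \<open>[2 n, B n]\<close> endpointwise, so convexity gives \<open>s m \<ge> t n\<close>;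
      subtracting \<open>G / n\<close> absorbs the resulting geometric series of errors.\<close>
    define m where "m = nat \<lfloor>\<rho> * n\<rfloor>"
    have "\<rho> * n \<ge> 0" using \<rho> by simp
    then have m_eq: "real m = of_int \<lfloor>\<rho> * n\<rfloor>" by (simp add: m_def)
    have m: "real m \<le> \<rho> * n" "real m > \<rho> * n - 1" unfolding m_eq by linarith+
    have "1 / (\<rho> - \<sigma>) < n" using that n0 by (simp add: n1_def)
    then have "1 < n * (\<rho> - \<sigma>)" using \<sigma> by (simp add: field_simps)
    then have m\<sigma>: "real m \<ge> \<sigma> * n" using m by (simp add: algebra_simps)
    have "1 * real n < \<sigma> * n" using \<sigma> n by (intro mult_strict_right_mono) auto
    with m\<sigma> have mn: "m > n" by simp
    have "A * m \<le> A * (\<rho> * n)" using AB m by (intro mult_left_mono) auto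
    also have "\<dots> = (A * \<rho>) * n" by simp
    also have "\<dots> \<le> 2 * real n" using \<rho> by (intro mult_right_mono) auto
    finally have Am: "A * m \<le> 2 * real n" .
    have "2 * real m \<le> (2 * \<rho>) * n" using m by simp
    also have "\<dots> \<le> B * n" using \<rho> by (intro mult_right_mono) auto
    finally have Bm: "2 * real m \<le> B * n" .
    have "(f (A * m) - f (2 * real m)) / (A * m - 2 * real m) \<le> (f (2 * real n) - f (B * n)) / (2 * real n - B * n)"
      using n AB Am Bm mn by (intro convex_on_slope_mono[OF conv]) auto
    moreover have "(f (2 * real n) - f (B * n)) / (2 * real n - B * n) = - t n"
      by (simp add: t_def minus_divide_right left_diff_distrib)
    moreover have "(f (A * m) - f (2 * real m)) / (A * m - 2 * real m) = - s m"
      by (simp add: s_def minus_divide_right left_diff_distrib)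
    ultimately have "- s m \<le> - t n" by (simp only:)
    with 1 have 2: "s n \<le> E / n + s m" by linarith
    have "G / m \<le> G / (\<sigma> * n)" using m\<sigma> mn n \<sigma> G by (intro divide_left_mono) auto
    then have "E / n \<le> G / n - G / m"
      by (subst G(2)[symmetric]) (simp add: diff_divide_distrib)
    with 2 have "s n - G / n \<le> s m - G / m" by linarith
    with m\<sigma> show ?thesis by blast
  qed
  \<comment> \<open>The lower bound \<open>c - e * x\<close> limits the drop over
    \<open>[A n, 2 n]\<close> to \<open>2 * e * n\<close> plus a constant, for every
    \<open>e > 0\<close>.\<close>
  have "s \<longlonglongrightarrow> 0"
  proof (rule LIMSEQ_I)
    fix r :: real assume r: "r > 0"
    \<comment> \<open>The drop comes out below \<open>5/2 * e * n\<close>, hence below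
      \<open>4 * e * n = r * (2 - A) * n\<close>.\<close>
    define e where "e = r * (2 - A) / 4"
    have e: "e > 0" using r AB by (simp add: e_def)
    obtain c where c: "\<And>x. x > 0 \<Longrightarrow> f x \<ge> c - e * x" using sublin[OF e] by blast
    obtain N :: nat where N: "(f A - c) / e < N / 2 " "N > 0"
    proof -
      define x where "x = (f A - c) / e"
      obtain N0 :: nat where "2 * x < N0" using reals_Archimedean2 by blast
      then have "x < real (Suc N0) / 2" by simp
      then show ?thesis unfolding x_def by (rule that) simp
    qed
    have "norm (s n - 0) < r" if "n \<ge> N" for n
    proof -
      have n: "n > 0" using that N by simp
      have "f (A * n) \<le> f A" using n AB by (intro anti) auto
      moreover have "f (2 * real n) \<ge> c - e * (2 * real n)" using n by (intro c) auto
      moreover have "(f A - c) / e < n / 2" using N that by simp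
      then have "f A - c < e * (n / 2)" using e by (simp add: field_simps)
      ultimately have "f (A * n) - f (2 * real n) < e * (n * 5/2)" using e by (simp add: algebra_simps)
      also have "\<dots> \<le> e * (4 * n)" using e n by (intro mult_left_mono) auto
      also have "\<dots> = r * ((2 - A) * n)" by (simp add: e_def)
      finally have "s n < r" using n AB by (simp add: s_def pos_divide_less_eq)
      then show ?thesis using s_nonneg[OF n] by simp
    qed
    then show "\<exists>N. \<forall>n\<ge>N. norm (s n - 0) < r" by blast
  qed
  then have lim: "(\<lambda>n. s n - G / n) \<longlonglongrightarrow> 0"
    using tendsto_diff[OF _ lim_const_over_n[of G], of s 0] by simp
  \<comment> \<open>The second entry covers the indices below \<open>n1\<close>, where monotonicity
    compares with \<open>f A\<close> and \<open>f (2 * real n1)\<close>.\<close>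
  define D where "D = max (G * (2 - A)) (f A - f (2 * real n1))"
  have "f (A * n) \<le> f (2 * real n) + D" if n: "n > 0" for n :: nat
  proof (cases "n \<ge> n1")
    case True
    have "s n - G / n \<le> 0"
      by (rule geometric_ascent_nonpos[OF \<sigma>(1) lim _ step True]) (simp_all add: n1_def)
    then have "f (A * n) - f (2 * real n) \<le> G / n * ((2 - A) * n)"
      using n AB by (simp add: s_def pos_divide_le_eq)
    then show ?thesis using n by (simp add: D_def)
  next
    case False
    have "f (A * n) \<le> f A" using n AB by (intro anti) auto
    moreover have "f (2 * real n1) \<le> f (2 * real n)" using n False by (intro anti) auto
    ultimately show ?thesis by (simp add: D_def)
  qed
  moreover have "G * (2 - A) \<ge> 0" using AB G by simp
  then have "D \<ge> 0" by (simp add: D_def le_max_iff_disj)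
  ultimately show ?thesis using that by blast
qed

text \<open>Passing from \<open>n\<close> to about \<open>A * n / 2\<close> costs \<open>D\<close>
  and shrinks the index by a fixed factor. A number of steps of order \<open>ln n\<close> reaches a
  bounded index, and their total cost is the logarithmic term.\<close>

lemma drop_bound_imp_log_lower_bound:
  fixes f :: "real \<Rightarrow> real" and A D :: real
  assumes anti: "\<And>x y. \<lbrakk>0 < x; x \<le> y\<rbrakk> \<Longrightarrow> f y \<le> f x"
    and A: "0 < A" "A < 2" and D: "D \<ge> 0" "\<And>n. n > (0::nat) \<Longrightarrow> f (A * n) \<le> f (2 * real n) + D"
  obtains K c where "\<And>n. n > (0::nat) \<Longrightarrow> f (2 * real n) \<ge> c - K * ln n"
proof -
  \<comment> \<open>The midpoint of \<open>A / 2\<close> and 1; the gap \<open>(2 - A) / 4\<close>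
    absorbs the rounding up in \<open>m\<close> once \<open>n > 4 / (2 - A)\<close>.\<close>
  define \<rho> where "\<rho> = (A + 2) / 4"
  have \<rho>: "0 < \<rho>" "\<rho> < 1" "A / 2 < \<rho>" using A by (auto simp: \<rho>_def)
  have ln\<rho>: "ln \<rho> < 0" using \<rho> by simp
  \<comment> \<open>Shrinking the index by the factor \<open>\<rho>\<close> lowers
    \<open>K * ln n\<close> by exactly \<open>D\<close>.\<close>
  define K where "K = D / (- ln \<rho>)"
  have K: "K \<ge> 0" "K * ln \<rho> = - D" using ln\<rho> D by (auto simp: K_def divide_nonneg_neg)
  obtain n0 :: nat where n0: "4 / (2 - A) < n0" using reals_Archimedean2 by blast
  have n0_pos: "n0 > 0" using n0 A by (auto intro: Nat.gr0I)
  have "f (2 * real n) \<ge> f (2 * real n0) - K * ln n" if "n > 0" for n :: nat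
    using that
  proof (induction n rule: less_induct)
    case (less n)
    show ?case
    proof (cases "n \<ge> n0")
      case False
      then have "f (2 * real n0) \<le> f (2 * real n)" using less.prems by (intro anti) auto
      moreover have "K * ln n \<ge> 0" using K less.prems by simp
      ultimately show ?thesis by linarith
    next
      case True
      define m where "m = nat \<lceil>A * n / 2\<rceil>"
      have pos: "A * n / 2 > 0" using less.prems A by simp
      then have m0: "m > 0" by (simp add: m_def)
      have m_eq: "real m = of_int \<lceil>A * n / 2\<rceil>" using pos by (simp add: m_def)
      have m1: "A * n / 2 \<le> m" "m < A * n / 2 + 1" unfolding m_eq by linarith+
      have "4 / (2 - A) < n" using n0 True by simp
      then have "4 < n * (2 - A)" using A by (simp add: field_simps)
      then have m2: "m \<le> \<rho> * n" using m1 by (simp add: \<rho>_def field_simps)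
      also have "\<dots> < 1 * real n" using \<rho> less.prems by (intro mult_strict_right_mono) auto
      finally have "m < n" by simp
      have "f (2 * real n0) - K * ln m \<le> f (2 * real m)" by (rule less.IH[OF \<open>m < n\<close> m0])
      also have "\<dots> \<le> f (A * n)" using pos m1 by (intro anti) auto
      also have "\<dots> \<le> f (2 * real n) + D" by (rule D(2)[OF less.prems])
      finally have 1: "f (2 * real n0) - K * ln m \<le> f (2 * real n) + D" .
      have "ln m \<le> ln (\<rho> * n)" using m2 m0 \<rho> less.prems by (subst ln_le_cancel_iff) auto
      then have "K * ln m \<le> K * (ln \<rho> + ln n)" using K \<rho> less.prems
        by (intro mult_left_mono) (auto simp: ln_mult)
      then show ?thesis using 1 K(2) by (simp add: ring_distribs)
    qed
  qed
  then show ?thesis using that by blast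
qed

section \<open>Moments and their logarithmic convexity\<close>

context radial_disc_measure begin

definition moment :: "real \<Rightarrow> real" where
  "moment x = (\<integral>z. cmod z powr x \<partial>\<nu>)"

lemma moment_integrable:
  assumes "x > 0"
  shows "integrable \<nu> (\<lambda>z. cmod z powr x)"
proof (rule integrable_bounded)
  show "(\<lambda>z. cmod z powr x) \<in> borel_measurable \<nu>"
    by (rule measurable_borel) measurable
  show "norm (cmod z powr x) \<le> 1" if "cmod z < 1" for z
    using that assms powr_mono2[of x "cmod z" 1] by simp
qed

lemma moment_lower_bound:
  assumes "0 \<le> r" "r < 1" "x > 0"
  shows "r powr x * measure \<nu> (ball 0 1 - cball 0 r) \<le> moment x"
  unfolding moment_def
proof (rule radial_lower_bound[OF assms(1,2)])
  show "t powr x \<le> 1" if "0 \<le> t" "t < 1" for t using that assms powr_mono2[of x t 1] by simp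
  show "r powr x \<le> t powr x" if "r \<le> t" for t using that assms by (intro powr_mono2) auto
qed auto

lemma moment_pos:
  assumes "x > 0"
  shows "moment x > 0"
proof -
  have "0 < (1/2) powr x * measure \<nu> (ball 0 1 - cball 0 (1/2))"
    using annulus_pos[of "1/2"] by simp
  also have "\<dots> \<le> moment x" using assms by (intro moment_lower_bound) auto
  finally show ?thesis .
qed

lemma moment_antimono:
  assumes "0 < x" "x \<le> y"
  shows "moment y \<le> moment x"
  unfolding moment_def
proof (rule integral_mono)
  show "cmod z powr y \<le> cmod z powr x" if "z \<in> space \<nu>" for z
    using that assms by (cases "z = 0") (auto simp: space_eq intro!: powr_mono')
qed (use assms in \<open>auto intro: moment_integrable\<close>)

lemma monomial_sqnorm_eq_moment:
  assumes "n > 0"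
  shows "monomial_sqnorm n = moment (2 * real n)"
proof -
  have "(cmod (z ^ n))\<^sup>2 = cmod z powr (2 * real n)" for z
  proof -
    have "(cmod (z ^ n))\<^sup>2 = cmod z ^ (2 * n)"
      by (simp add: norm_power power_mult[symmetric] mult.commute)
    also have "\<dots> = cmod z powr real (2 * n)"
      using assms by (intro powr_realpow'[symmetric]) auto
    finally show ?thesis by simp
  qed
  then show ?thesis by (simp add: monomial_sqnorm_def sqnorm_def moment_def)
qed

text \<open>Hoelder's inequality with exponents \<open>1 / (1 - t)\<close> and \<open>1 / t\<close>,
  obtained by integrating Young's inequality for the powers divided by their moments.\<close>

lemma ln_moment_convex: "convex_on {0<..} (\<lambda>x. ln (moment x))"
proof (rule convex_onI)
  fix t x y :: real assume t: "0 < t" "t < 1" and "x \<in> {0<..}" "y \<in> {0<..}"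
  then have xy: "x > 0" "y > 0" by auto
  define w where "w = (1 - t) *\<^sub>R x + t *\<^sub>R y"
  have w: "w > 0" using t xy by (simp add: w_def add_pos_pos)
  define P where "P = moment x powr (1 - t) * moment y powr t"
  have P: "P > 0" using moment_pos[OF xy(1)] moment_pos[OF xy(2)] by (simp add: P_def)
  have pt: "cmod z powr w / P \<le> (1 - t) * (cmod z powr x / moment x) + t * (cmod z powr y / moment y)" for z
  proof (cases "z = 0")
    case False
    have "cmod z powr w / P = (cmod z powr x / moment x) powr (1 - t) * (cmod z powr y / moment y) powr t"
      using moment_pos xy False
      by (simp add: P_def w_def powr_divide powr_powr powr_add mult.commute)
    also have "\<dots> \<le> (1 - t) * (cmod z powr x / moment x) + t * (cmod z powr y / moment y)"
      using t False moment_pos xy by (intro Youngs_inequality_0) auto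
    finally show ?thesis .
  qed simp
  have "moment w / P = (\<integral>z. cmod z powr w / P \<partial>\<nu>)" by (simp add: moment_def)
  also have "\<dots> \<le> (\<integral>z. (1 - t) * (cmod z powr x / moment x) + t * (cmod z powr y / moment y) \<partial>\<nu>)"
    using w xy
    by (intro integral_mono pt Bochner_Integration.integrable_add integrable_mult_right
        integrable_divide_zero moment_integrable) auto
  also have "\<dots> = (1 - t) * (moment x / moment x) + t * (moment y / moment y)"
    using xy by (simp add: moment_integrable flip: moment_def)
  also have "\<dots> = 1" using moment_pos[OF xy(1)] moment_pos[OF xy(2)] by simp
  finally have "moment w \<le> P" using P by simp
  then have "ln (moment w) \<le> ln P" using moment_pos[OF w] P by simp
  also have "\<dots> = (1 - t) * ln (moment x) + t * ln (moment y)"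
    using moment_pos[OF xy(1)] moment_pos[OF xy(2)] by (simp add: P_def ln_mult ln_powr)
  finally show "ln (moment ((1 - t) *\<^sub>R x + t *\<^sub>R y)) \<le> (1 - t) * ln (moment x) + t * ln (moment y)"
    by (simp add: w_def)
qed auto

text \<open>The logarithm of the hypothesis, multiplied by \<open>p / (p + 1)\<close>, is the
  reversed convexity inequality. The nodes \<open>p\<close> and \<open>1 + 2 / p\<close> lie on
  opposite sides of 2, and the smaller one serves as \<open>A\<close>.\<close>

lemma moment_inequality_imp_power_lower_bound:
  assumes p: "p > 0" "p \<noteq> 2"
    and C: "\<And>n. n > (0::nat) \<Longrightarrow>
      moment ((1 + 2 / p) * n) / moment (2 * real n) * moment (p * n) powr (1 / p) \<le> C * moment (2 * real n) powr (1 / p)"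
  obtains c K where "\<And>n. n > (0::nat) \<Longrightarrow> ln (moment (2 * real n)) \<ge> c - K * ln n"
proof -
  define f where "f x = ln (moment x)" for x
  have anti: "f y \<le> f x" if "0 < x" "x \<le> y" for x y
    using that moment_antimono[of x y] moment_pos[of x] moment_pos[of y] by (simp add: f_def)
  have conv: "convex_on {0<..} f" unfolding f_def by (rule ln_moment_convex)
  have sublin: "\<exists>c. \<forall>x>0. f x \<ge> c - e * x" if e: "e > 0" for e
  proof -
    \<comment> \<open>This makes \<open>r powr x\<close> equal to \<open>exp (- e * x)\<close>, so
      the mass of the annulus gives a linear lower bound of slope \<open>- e\<close>.\<close>
    define r where "r = exp (- e)"
    define m where "m = measure \<nu> (ball 0 1 - cball 0 r)"
    have r: "0 \<le> r" "r < 1" using e by (auto simp: r_def)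
    have m: "m > 0" using annulus_pos[OF r] by (simp add: m_def)
    have "f x \<ge> ln m - e * x" if "x > 0" for x
    proof -
      have "ln (r powr x * m) \<le> f x"
        using moment_lower_bound[OF r that] m moment_pos[OF that] unfolding f_def m_def
        by (subst ln_le_cancel_iff) (auto simp: r_def)
      also have "ln (r powr x * m) = ln m - e * x"
        using m by (simp add: ln_mult ln_powr r_def)
      finally show ?thesis .
    qed
    then show ?thesis by blast
  qed
  \<comment> \<open>The weights for which 2 is the mean of \<open>p\<close> and
    \<open>1 + 2 / p\<close>.\<close>
  define a b where "a = 1 / (p + 1)" and "b = p / (p + 1)"
  have ab: "0 < a" "0 < b" "a + b = 1"
    using p by (auto simp: a_def b_def field_simps)
  have "1 + 2 / p = (p + 2) / p" using p by (simp add: add_divide_distrib)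
  then have "b * (1 + 2 / p) = (p + 2) / (p + 1)" using p by (simp add: b_def)
  then have "a * p + b * (1 + 2 / p) = (2 * (p + 1)) / (p + 1)"
    by (simp add: a_def add_divide_distrib[symmetric])
  also have "\<dots> = 2" using p by (intro nonzero_mult_div_cancel_right) simp
  finally have ab2: "a * p + b * (1 + 2 / p) = 2" .
  have C': "a * f (p * n) + b * f ((1 + 2 / p) * n) \<le> f (2 * real n) + b * ln C" if n: "n > 0" for n :: nat
  proof -
    have pos: "moment ((1 + 2 / p) * n) > 0" "moment (2 * real n) > 0" "moment (p * n) > 0"
      using n p by (auto intro!: moment_pos mult_pos_pos add_pos_pos)
    have "0 < moment ((1 + 2 / p) * n) / moment (2 * real n) * moment (p * n) powr (1 / p)"
      using pos by simp
    also note C[OF n]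
    finally have "C > 0" using pos by (simp add: zero_less_mult_iff)
    have "ln (moment ((1 + 2 / p) * n) / moment (2 * real n) * moment (p * n) powr (1 / p)) \<le> ln (C * moment (2 * real n) powr (1 / p))"
      using pos \<open>C > 0\<close> C[OF n] by (subst ln_le_cancel_iff) auto
    then have "f ((1 + 2 / p) * n) - f (2 * real n) + f (p * n) / p \<le> ln C + f (2 * real n) / p"
      using pos \<open>C > 0\<close> by (simp add: f_def ln_mult ln_div ln_powr)
    then have "b * (f ((1 + 2 / p) * n) - f (2 * real n) + f (p * n) / p) \<le> b * (ln C + f (2 * real n) / p)"
      using ab by (intro mult_left_mono) auto
    moreover have bp: "b / p = a" using p by (simp add: a_def b_def)
    have "b * (x / p) = a * x" for x unfolding bp[symmetric] by simp
    ultimately have "b * f ((1 + 2 / p) * n) - b * f (2 * real n) + a * f (p * n) \<le> b * ln C + a * f (2 * real n)"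
      by (simp add: ring_distribs)
    moreover have "b * f (2 * real n) + a * f (2 * real n) = f (2 * real n)"
      using ab(3) by (metis add.commute distrib_right mult_1)
    ultimately show ?thesis by linarith
  qed
  obtain A D :: real where A: "0 < A" "A < 2" and D: "D \<ge> 0" "\<And>n. n > (0::nat) \<Longrightarrow> f (A * n) \<le> f (2 * real n) + D"
  proof (cases "p < 2")
    case True
    then have B: "2 < 1 + 2 / p" using p by (simp add: field_simps)
    obtain D where "D \<ge> 0" "\<And>n. n > (0::nat) \<Longrightarrow> f (p * n) \<le> f (2 * real n) + D"
      by (rule decreasing_convex_drop_bound[OF conv anti sublin p(1) True B ab ab2 C']) (assumption+, rule that, assumption+)
    with True p show ?thesis by (intro that[of p]) auto
  next
    case False
    then have p2: "2 < p" using p by simp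
    then have A: "1 + 2 / p < 2" "0 < 1 + 2 / p" using p by (auto simp: field_simps)
    have ba: "b + a = 1" "b * (1 + 2 / p) + a * p = 2" using ab ab2 by auto
    have C'': "b * f ((1 + 2 / p) * n) + a * f (p * n) \<le> f (2 * real n) + b * ln C" if "n > 0" for n :: nat
      using C'[OF that] by linarith
    obtain D where "D \<ge> 0" "\<And>n. n > (0::nat) \<Longrightarrow> f ((1 + 2 / p) * n) \<le> f (2 * real n) + D"
      by (rule decreasing_convex_drop_bound[OF conv anti sublin A(2,1) p2 ab(2,1) ba C'']) (assumption+, rule that, assumption+)
    with A show ?thesis by (intro that[of "1 + 2 / p"]) auto
  qed
  obtain K c where "\<And>n. n > (0::nat) \<Longrightarrow> f (2 * real n) \<ge> c - K * ln n"
    by (rule drop_bound_imp_log_lower_bound[OF anti A D]) (assumption+, rule that, assumption+)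
  then show ?thesis unfolding f_def by (intro that) auto
qed

end

section \<open>Rotation invariance of the weighted area measure\<close>

text \<open>These coordinates carry the invariance of Lebesgue measure under orthogonal maps of
  \<open>real ^ 2\<close> over to the complex plane.\<close>

definition vec_to_complex :: "real ^ 2 \<Rightarrow> complex" where
  "vec_to_complex x = Complex (x $ 1) (x $ 2)"

definition complex_to_vec :: "complex \<Rightarrow> real ^ 2" where
  "complex_to_vec z = (\<chi> i. if i = 1 then Re z else Im z)"

lemma vec_to_complex_inverse [simp]:
  "vec_to_complex (complex_to_vec z) = z" "complex_to_vec (vec_to_complex x) = x"
  by (simp_all add: vec_to_complex_def complex_to_vec_def vec_eq_iff forall_2)

lemma vimage_vec_to_complex_box:
  "vec_to_complex -` box l u = box (complex_to_vec l) (complex_to_vec u)"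
  by (auto simp: vec_to_complex_def complex_to_vec_def box_Complex_eq in_box_complex_iff mem_box_cart forall_2)

lemma emeasure_box_complex_to_vec:
  assumes "Re l \<le> Re u" "Im l \<le> Im u"
  shows "emeasure lborel (box (complex_to_vec l) (complex_to_vec u)) = ennreal ((Re u - Re l) * (Im u - Im l))"
proof -
  have basis: "(Basis :: (real ^ 2) set) = {axis 1 1, axis 2 1}"
    by (auto simp: Basis_vec_def UNIV_2)
  have ne: "axis 1 1 \<noteq> (axis 2 1 :: real ^ 2)" by (simp add: axis_eq_axis)
  show ?thesis
    using assms ne
    by (subst emeasure_lborel_box) (auto simp: basis complex_to_vec_def inner_axis)
qed

lemma measurable_vec_to_complex: "vec_to_complex \<in> borel_measurable borel"
proof -
  have "continuous_on UNIV vec_to_complex"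
    unfolding vec_to_complex_def [abs_def] by (intro continuous_intros)
  then show ?thesis by (rule borel_measurable_continuous_onI)
qed

lemma lborel_complex_eq_distr: "(lborel :: complex measure) = distr lborel borel vec_to_complex"
proof (rule lborel_eqI)
  fix l u :: complex assume lu: "\<And>b. b \<in> Basis \<Longrightarrow> l \<bullet> b \<le> u \<bullet> b"
  have "Re l \<le> Re u" "Im l \<le> Im u"
    using lu[of 1] lu[of \<i>] by (auto simp: Basis_complex_def)
  then show "emeasure (distr lborel borel vec_to_complex) (box l u) = ennreal (\<Prod>b\<in>Basis. (u - l) \<bullet> b)"
    using measurable_vec_to_complex
    by (simp add: emeasure_distr vimage_vec_to_complex_box emeasure_box_complex_to_vec Basis_complex_def)
qed simp

text \<open>It suffices to measure boxes. In coordinates, the preimage of a box under multiplication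
  by \<open>c\<close> is the image of a box under an orthogonal map, which preserves Lebesgue
  measure.\<close>

lemma lborel_distr_complex_rotation:
  assumes c: "cmod c = 1"
  shows "distr lborel borel ((*) c) = (lborel :: complex measure)"
proof (rule lborel_eqI[symmetric])
  fix l u :: complex assume lu: "\<And>b. b \<in> Basis \<Longrightarrow> l \<bullet> b \<le> u \<bullet> b"
  have le: "Re l \<le> Re u" "Im l \<le> Im u"
    using lu[of 1] lu[of \<i>] by (auto simp: Basis_complex_def)
  \<comment> \<open>Multiplication by \<open>cnj c\<close> inverts multiplication by
    \<open>c\<close>, so images under \<open>R\<close> are the preimages to be measured.\<close>
  define R where "R x = complex_to_vec (cnj c * vec_to_complex x)" for x
  have cc: "c * cnj c = 1" using complex_norm_square[of c] c by simp
  have norm_vec: "norm (complex_to_vec z) = cmod z" for z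
    by (simp add: norm_vec_def L2_set_def complex_to_vec_def sum_2 cmod_def)
  have "linear R"
    by (rule linearI) (auto simp: R_def complex_to_vec_def vec_to_complex_def vec_eq_iff forall_2 algebra_simps)
  moreover have "norm (R x) = norm x" for x
  proof -
    have "norm (R x) = cmod (vec_to_complex x)" using c by (simp add: R_def norm_vec norm_mult)
    also have "\<dots> = norm x" using norm_vec[of "vec_to_complex x"] by simp
    finally show ?thesis .
  qed
  ultimately have R: "orthogonal_transformation R" by (simp add: orthogonal_transformation)
  define B where "B = box (complex_to_vec l) (complex_to_vec u)"
  have B: "B \<in> lmeasurable" by (simp add: B_def lmeasurable_box)
  have vim: "vec_to_complex -` ((*) c -` box l u) = R ` B"
  proof (intro set_eqI iffI)
    fix x assume "x \<in> vec_to_complex -` ((*) c -` box l u)"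
    then have "complex_to_vec (c * vec_to_complex x) \<in> B"
      by (simp add: B_def flip: vimage_vec_to_complex_box)
    moreover have "R (complex_to_vec (c * vec_to_complex x)) = x"
      using cc by (simp add: R_def mult.assoc[symmetric] mult.commute[of "cnj c"])
    ultimately show "x \<in> R ` B" by force
  next
    fix x assume "x \<in> R ` B"
    then show "x \<in> vec_to_complex -` ((*) c -` box l u)"
      using cc by (auto simp: R_def B_def mult.assoc[symmetric] simp flip: vimage_vec_to_complex_box)
  qed
  have mult_m: "(*) c \<in> borel_measurable borel" by measurable
  have S: "(*) c -` box l u \<in> sets borel"
    using measurable_sets[OF mult_m, of "box l u"] by simp
  have T: "vec_to_complex -` ((*) c -` box l u) \<in> sets borel"
    using measurable_sets[OF measurable_vec_to_complex S] by simp
  have "emeasure (distr lborel borel ((*) c)) (box l u) = emeasure lborel ((*) c -` box l u)"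
    using mult_m by (simp add: emeasure_distr)
  also have "\<dots> = emeasure lborel (R ` B)"
    using measurable_vec_to_complex S
    by (subst lborel_complex_eq_distr) (simp add: emeasure_distr vim)
  also have "\<dots> = emeasure lebesgue (R ` B)"
    using T unfolding vim by simp
  also have "\<dots> = ennreal (measure lebesgue B)"
    using measurable_orthogonal_image[OF R B] measure_orthogonal_image[OF R B]
    by (simp add: emeasure_eq_measure2)
  also have "\<dots> = emeasure lborel B"
    using B by (subst emeasure_eq_measure2[symmetric]) (auto simp: B_def)
  also have "\<dots> = ennreal (\<Prod>b\<in>Basis. (u - l) \<bullet> b)"
    using le by (simp add: B_def emeasure_box_complex_to_vec Basis_complex_def)
  finally show "emeasure (distr lborel borel ((*) c)) (box l u) = ennreal (\<Prod>b\<in>Basis. (u - l) \<bullet> b)" .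
qed simp

section \<open>Integration against normalized area measure\<close>

lemma space_disc_measure [simp]: "space disc_measure = ball 0 1"
  by (simp add: disc_measure_def)

lemma sets_disc_measure: "sets disc_measure = sets (lebesgue_on (ball 0 1))"
  by (simp add: disc_measure_def)

lemma borel_measurable_disc:
  assumes "f \<in> borel_measurable borel"
  shows "f \<in> borel_measurable disc_measure"
proof -
  have "f \<in> borel_measurable lebesgue" using assms by (intro measurable_completion) simp
  then have "f \<in> borel_measurable (lebesgue_on (ball 0 1))" by (rule measurable_restrict_space1)
  then show ?thesis by (simp add: disc_measure_def)
qed

text \<open>For Borel integrands the completed measure can be replaced by \<open>lborel\<close>,
  where the rotation formula is available.\<close>

lemma integral_disc_measure:
  fixes f :: "complex \<Rightarrow> complex"
  assumes "f \<in> borel_measurable borel"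
  shows "(\<integral>z. f z \<partial>disc_measure) = (1 / pi) *\<^sub>R (\<integral>z. indicator (ball 0 1) z *\<^sub>R f z \<partial>lborel)"
proof -
  have "f \<in> borel_measurable lebesgue" using assms by (intro measurable_completion) simp
  then have "f \<in> borel_measurable (lebesgue_on (ball 0 1))" by (rule measurable_restrict_space1)
  then have "(\<integral>z. f z \<partial>disc_measure) = (\<integral>z. (1 / pi) *\<^sub>R f z \<partial>lebesgue_on (ball 0 1))"
    unfolding disc_measure_def by (intro integral_density) auto
  also have "\<dots> = (1 / pi) *\<^sub>R (\<integral>z. f z \<partial>lebesgue_on (ball 0 1))" by simp
  also have "(\<integral>z. f z \<partial>lebesgue_on (ball 0 1)) = (\<integral>z. indicator (ball 0 1) z *\<^sub>R f z \<partial>lebesgue)"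
    by (subst integral_restrict_space) auto
  also have "\<dots> = (\<integral>z. indicator (ball 0 1) z *\<^sub>R f z \<partial>lborel)"
    using assms by (intro integral_completion borel_measurable_scaleR borel_measurable_indicator) auto
  finally show ?thesis .
qed

lemma integral_disc_rotation:
  fixes f :: "complex \<Rightarrow> complex"
  assumes c: "cmod c = 1" and f: "f \<in> borel_measurable borel"
  shows "(\<integral>z. f (c * z) \<partial>disc_measure) = (\<integral>z. f z \<partial>disc_measure)"
proof -
  let ?g = "\<lambda>z. indicator (ball 0 1) z *\<^sub>R f z"
  have g: "?g \<in> borel_measurable borel"
    using f by (intro borel_measurable_scaleR borel_measurable_indicator) auto
  have mult_m: "(*) c \<in> borel_measurable borel" by measurable
  have "(\<lambda>z. f (c * z)) \<in> borel_measurable borel" using measurable_compose[OF mult_m f] by simp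
  then have "(\<integral>z. f (c * z) \<partial>disc_measure) = (1 / pi) *\<^sub>R (\<integral>z. indicator (ball 0 1) z *\<^sub>R f (c * z) \<partial>lborel)"
    by (rule integral_disc_measure)
  also have "(\<integral>z. indicator (ball 0 1) z *\<^sub>R f (c * z) \<partial>lborel) = (\<integral>z. ?g (c * z) \<partial>lborel)"
    using c by (intro Bochner_Integration.integral_cong) (auto simp: indicator_def norm_mult)
  also have "\<dots> = (\<integral>z. ?g z \<partial>distr lborel borel ((*) c))"
    using mult_m g by (subst integral_distr) auto
  also have "\<dots> = (\<integral>z. ?g z \<partial>lborel)" by (simp add: lborel_distr_complex_rotation[OF c])
  finally show ?thesis using integral_disc_measure[OF f] by simp
qed

section \<open>The weighted area measure and its Bergman projection\<close>

locale continuous_radial_weight =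
  fixes w :: "complex \<Rightarrow> real"
  assumes weight: "weight w" and radial: "radial w" and continuous: "continuous_on (ball 0 1) w"
begin

definition \<mu> :: "complex measure" where
  "\<mu> = density disc_measure (\<lambda>z. ennreal (w z))"

lemma w_pos: "z \<in> ball 0 1 \<Longrightarrow> w z > 0"
  and w_integrable: "integrable disc_measure w"
  using weight by (auto simp: weight_def)

lemma w_measurable: "w \<in> borel_measurable disc_measure"
  using w_integrable by simp

lemma w_nonneg: "AE z in disc_measure. 0 \<le> w z"
  by (intro AE_I2) (auto intro: less_imp_le[OF w_pos])

lemma space_\<mu>: "space \<mu> = ball 0 1" and sets_\<mu>: "sets \<mu> = sets disc_measure"
  by (simp_all add: \<mu>_def)

lemma measurable_\<mu>: "f \<in> borel_measurable \<mu> \<longleftrightarrow> f \<in> borel_measurable disc_measure"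
  by (simp add: \<mu>_def)

lemma integral_\<mu>:
  fixes f :: "complex \<Rightarrow> 'b::{banach, second_countable_topology}"
  assumes "f \<in> borel_measurable disc_measure"
  shows "(\<integral>z. f z \<partial>\<mu>) = (\<integral>z. w z *\<^sub>R f z \<partial>disc_measure)"
  unfolding \<mu>_def using assms w_measurable w_nonneg by (intro integral_density) auto

lemma integrable_\<mu>:
  fixes f :: "complex \<Rightarrow> 'b::{banach, second_countable_topology}"
  assumes "f \<in> borel_measurable disc_measure"
  shows "integrable \<mu> f \<longleftrightarrow> integrable disc_measure (\<lambda>z. w z *\<^sub>R f z)"
  unfolding \<mu>_def using assms w_measurable w_nonneg by (intro integrable_density) auto

lemma finite_measure_\<mu>: "finite_measure \<mu>"
proof (rule finite_measureI)
  have "integrable \<mu> (\<lambda>_. 1 :: real)"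
    by (subst integrable_\<mu>) (auto simp: w_integrable)
  then show "emeasure \<mu> (space \<mu>) \<noteq> \<infinity>"
    by (simp add: integrable_iff_bounded)
qed

sublocale radial_disc_measure \<mu>
proof (intro radial_disc_measure.intro finite_measure_\<mu> radial_disc_measure_axioms.intro)
  show "space \<mu> = ball 0 1" by (rule space_\<mu>)
  show "(\<lambda>z. z) \<in> borel_measurable \<mu>"
    unfolding measurable_\<mu> by (rule borel_measurable_disc) simp
  fix c :: complex and f :: "complex \<Rightarrow> complex"
  assume c: "cmod c = 1" and f: "f \<in> borel_measurable borel"
  \<comment> \<open>Cutting the continuous \<open>w\<close> off outside the disc makes the weighted
    integrand Borel on the whole plane, as \<open>integral_disc_rotation\<close> requires.\<close>
  define g where "g z = (indicator (ball 0 1) z *\<^sub>R w z) *\<^sub>R f z" for z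
  have "(\<lambda>z. indicator (ball 0 1) z *\<^sub>R w z) \<in> borel_measurable borel"
    using continuous by (intro borel_measurable_continuous_on_indicator) auto
  then have g: "g \<in> borel_measurable borel" unfolding g_def using f by (rule borel_measurable_scaleR)
  have mult_m: "(*) c \<in> borel_measurable borel" by measurable
  have fc: "(\<lambda>z. f (c * z)) \<in> borel_measurable borel" using measurable_compose[OF mult_m f] by simp
  have wc: "w (c * z) = w z" if "z \<in> ball 0 1" for z
  proof -
    have rad: "w z = w (of_real (cmod z))" if "z \<in> ball 0 1" for z
      using radial that unfolding radial_def by (rule bspec)
    have "cmod (c * z) = cmod z" using c by (simp add: norm_mult)
    with rad[of "c * z"] rad[OF that] show ?thesis using that by (simp only: mem_ball dist_0_norm)
  qed
  have "(\<integral>z. f (c * z) \<partial>\<mu>) = (\<integral>z. w z *\<^sub>R f (c * z) \<partial>disc_measure)"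
    using fc by (intro integral_\<mu> borel_measurable_disc)
  also have "\<dots> = (\<integral>z. g (c * z) \<partial>disc_measure)"
    using c wc by (intro Bochner_Integration.integral_cong) (auto simp: g_def norm_mult)
  also have "\<dots> = (\<integral>z. g z \<partial>disc_measure)" by (rule integral_disc_rotation[OF c g])
  also have "\<dots> = (\<integral>z. w z *\<^sub>R f z \<partial>disc_measure)"
    by (intro Bochner_Integration.integral_cong) (auto simp: g_def)
  also have "\<dots> = (\<integral>z. f z \<partial>\<mu>)"
    using f by (intro integral_\<mu>[symmetric] borel_measurable_disc)
  finally show "(\<integral>z. f (c * z) \<partial>\<mu>) = (\<integral>z. f z \<partial>\<mu>)" .
next
  \<comment> \<open>A set that is null for the weighted measure is null for area because
    \<open>w\<close> is positive, and a nonempty open set is not negligible.\<close>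
  fix U :: "complex set" assume U: "open U" "U \<noteq> {}" "U \<subseteq> ball 0 1"
  have Us: "U \<in> sets lebesgue" using U(1) by auto
  then have Us': "U \<in> sets (lebesgue_on (ball 0 1))"
    using U(3) by (auto simp: sets_restrict_space_iff)
  show "emeasure \<mu> U \<noteq> 0"
  proof
    assume "emeasure \<mu> U = 0"
    then have "U \<in> null_sets \<mu>" using Us' by (auto simp: null_sets_def sets_\<mu> sets_disc_measure)
    moreover have "(\<lambda>z. ennreal (w z)) \<in> borel_measurable disc_measure"
      using w_measurable by measurable
    ultimately have "AE z in disc_measure. z \<in> U \<longrightarrow> ennreal (w z) = 0"
      unfolding \<mu>_def by (simp only: null_sets_density_iff)
    moreover have "ennreal (w z) \<noteq> 0" if "z \<in> U" for z
      using w_pos[of z] U(3) that by (auto simp: ennreal_eq_0_iff)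
    ultimately have "AE z in disc_measure. z \<notin> U" by (auto elim: AE_mp)
    moreover have "(\<lambda>_ :: complex. ennreal (1 / pi)) \<in> borel_measurable (lebesgue_on (ball 0 1))" by simp
    ultimately have "AE z in lebesgue_on (ball 0 1). (0 :: ennreal) < ennreal (1 / pi) \<longrightarrow> z \<notin> U"
      unfolding disc_measure_def by (simp only: AE_density)
    then have "AE z in lebesgue_on (ball 0 1). z \<notin> U" by simp
    then have "U \<in> null_sets (lebesgue_on (ball 0 1))"
      using AE_iff_null_sets[OF Us'] by simp
    then have "U \<in> null_sets lebesgue"
      using null_sets_restrict_space[of "ball 0 1" lebesgue U] by simp
    then have "negligible U" by (simp add: negligible_iff_null_sets)
    then show False using open_not_negligible[OF U(1,2)] by simp
  qed
qed

lemma integral_\<mu>_powr: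
  assumes "f \<in> borel_measurable disc_measure"
  shows "(\<integral>z. cmod (f z) powr p \<partial>\<mu>) = (\<integral>z. cmod (f z) powr p * w z \<partial>disc_measure)"
    and "integrable \<mu> (\<lambda>z. cmod (f z) powr p) \<longleftrightarrow> integrable disc_measure (\<lambda>z. cmod (f z) powr p * w z)"
proof -
  have m: "(\<lambda>z. cmod (f z) powr p) \<in> borel_measurable disc_measure" using assms by measurable
  show "(\<integral>z. cmod (f z) powr p \<partial>\<mu>) = (\<integral>z. cmod (f z) powr p * w z \<partial>disc_measure)"
    by (simp add: integral_\<mu>[OF m] mult.commute)
  show "integrable \<mu> (\<lambda>z. cmod (f z) powr p) \<longleftrightarrow> integrable disc_measure (\<lambda>z. cmod (f z) powr p * w z)"
    by (simp add: integrable_\<mu>[OF m] mult.commute)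
qed

lemma Lp_space_eq: "Lp_space p w = {f \<in> borel_measurable \<mu>. integrable \<mu> (\<lambda>z. cmod (f z) powr p)}"
  using integral_\<mu>_powr(2) by (auto simp: Lp_space_def measurable_\<mu>)

lemma Lp_norm_eq:
  "f \<in> borel_measurable \<mu> \<Longrightarrow> Lp_norm p w f = (\<integral>z. cmod (f z) powr p \<partial>\<mu>) powr (1 / p)"
  using integral_\<mu>_powr(1) by (simp add: Lp_norm_def measurable_\<mu>)

lemma Lp_space_2: "Lp_space 2 w = L2"
  unfolding Lp_space_eq L2_def by simp

lemma bergman_space_eq: "bergman_space w = A2"
  by (simp add: bergman_space_def A2_def Lp_space_2)

lemma L2_inner_eq:
  assumes "f \<in> L2" "g \<in> L2"
  shows "L2_inner w f g = ip f g"
proof -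
  have "(\<lambda>z. f z * cnj (g z)) \<in> borel_measurable disc_measure"
    by (rule measurable_\<mu>[THEN iffD1, OF borel_measurable_integrable[OF integrable_mult[OF assms]]])
  then show ?thesis
    by (simp add: L2_inner_def ip_def integral_\<mu> scaleR_conv_of_real mult_ac)
qed

text \<open>The definite description is resolved by uniqueness: on the disc by
  \<open>projection_unique\<close>, off the disc by the normalisation to 0.\<close>

lemma bergman_projection_eqI:
  assumes f: "f \<in> L2" and g: "g \<in> A2" "\<And>z. z \<notin> ball 0 1 \<Longrightarrow> g z = 0"
    and orth: "\<And>h. h \<in> A2 \<Longrightarrow> ip (\<lambda>z. f z - g z) h = 0"
  shows "bergman_projection w f = g"
  unfolding bergman_projection_def bergman_space_eq
proof (rule the_equality)
  show "g \<in> A2 \<and> (\<forall>z. z \<notin> ball 0 1 \<longrightarrow> g z = 0) \<and> (\<forall>h\<in>A2. L2_inner w (\<lambda>z. f z - g z) h = 0)"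
    using f g orth by (simp add: L2_inner_eq L2_diff A2_L2)
  fix g' assume g': "g' \<in> A2 \<and> (\<forall>z. z \<notin> ball 0 1 \<longrightarrow> g' z = 0) \<and> (\<forall>h\<in>A2. L2_inner w (\<lambda>z. f z - g' z) h = 0)"
  then have orth': "ip (\<lambda>z. f z - g' z) h = 0" if "h \<in> A2" for h
    using that f by (simp add: L2_inner_eq[symmetric] L2_diff A2_L2)
  have "g' z = g z" for z
  proof (cases "z \<in> ball 0 1")
    case True
    show ?thesis by (rule projection_unique[OF _ orth' g(1) orth f True]) (use g' in auto)
  qed (use g' g(2) in auto)
  then show "g' = g" by auto
qed

lemma bergman_projection_bounded_2: "bergman_projection_bounded 2 w"
  unfolding bergman_projection_bounded_def
proof (intro exI[of _ 1] ballI)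
  fix f assume "f \<in> Lp_space 2 w \<inter> Lp_space 2 w"
  then have f: "f \<in> L2" by (simp add: Lp_space_2)
  obtain g where g: "g \<in> A2" "\<And>z. z \<notin> ball 0 1 \<Longrightarrow> g z = 0"
    "\<And>h. h \<in> A2 \<Longrightarrow> ip (\<lambda>z. f z - g z) h = 0" using projection_exists[OF f] by metis
  have P: "bergman_projection w f = g" by (rule bergman_projection_eqI[OF f g])
  have norm: "Lp_norm 2 w h = sqrt (sqnorm h)" if "h \<in> L2" for h
    using L2_measurable[OF that] sqnorm_nonneg[of h]
    by (simp add: Lp_norm_eq sqnorm_def powr_half_sqrt)
  show "bergman_projection w f \<in> Lp_space 2 w \<and> Lp_norm 2 w (bergman_projection w f) \<le> 1 * Lp_norm 2 w f"
    using projection_contraction[OF f g(1,3)] A2_L2[OF g(1)] f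
    by (simp add: P norm Lp_space_2)
qed

lemma bounded_imp_moment_inequality:
  assumes bd: "bergman_projection_bounded p w" and p: "p > 0"
  obtains C where "\<And>n. n > (0::nat) \<Longrightarrow>
    moment ((1 + 2 / p) * n) / moment (2 * real n) * moment (p * n) powr (1 / p) \<le> C * moment (2 * real n) powr (1 / p)"
proof -
  obtain C where C: "\<And>f. f \<in> Lp_space 2 w \<inter> Lp_space p w \<Longrightarrow>
      Lp_norm p w (bergman_projection w f) \<le> C * Lp_norm p w f"
    using bd unfolding bergman_projection_bounded_def by blast
  have "moment ((1 + 2 / p) * n) / moment (2 * real n) * moment (p * n) powr (1 / p) \<le> C * moment (2 * real n) powr (1 / p)"
    if n: "n > 0" for n :: nat
  proof -
    \<comment> \<open>The exponent makes \<open>cmod (f z) powr p\<close> equal to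
      \<open>cmod z powr (2 * n)\<close>, so the norm of \<open>f\<close> involves the same moment
      as the denominator of \<open>c\<close>.\<close>
    define F :: "real \<Rightarrow> real" where "F t = t powr (2 * n / p)" for t
    define f :: "complex \<Rightarrow> complex" where "f = (\<lambda>z. of_real (F (cmod z)) * sgn z ^ n)"
    \<comment> \<open>The coefficient from \<open>radial_projection\<close>: its numerator
      integrates \<open>cmod z\<close> to the exponent \<open>2 * n / p + n\<close>.\<close>
    define c where "c = moment ((1 + 2 / p) * n) / moment (2 * real n)"
    define g :: "complex \<Rightarrow> complex" where "g z = (if z \<in> ball 0 1 then of_real c * z ^ n else 0)" for z
    have exps: "(1 + 2 / p) * n > 0" "2 * real n > 0" "p * n > 0" "2 * n / p > 0"
      using n p by (auto intro!: mult_pos_pos add_pos_pos)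
    have c: "c > 0" using exps moment_pos by (simp add: c_def)
    have F: "F \<in> borel_measurable borel" unfolding F_def by measurable
    have F1: "\<bar>F t\<bar> \<le> 1" if "0 \<le> t" "t < 1" for t
      using that exps powr_mono2[of "2 * n / p" t 1] by (simp add: F_def)
    have cf: "cmod (f z) = cmod z powr (2 * n / p)" for z
      using n by (cases "z = 0") (auto simp: f_def F_def norm_mult norm_power norm_sgn)
    have "(\<lambda>z::complex. sgn z) \<in> borel_measurable borel"
      unfolding sgn_div_norm by measurable
    moreover have "(\<lambda>z. complex_of_real (F (cmod z))) \<in> borel_measurable borel"
      by (intro measurable_compose[OF _ borel_measurable_of_real] measurable_compose[OF _ F]) auto
    ultimately have "f \<in> borel_measurable borel"
      unfolding f_def by (intro borel_measurable_times borel_measurable_power)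
    then have f_meas: "f \<in> borel_measurable \<mu>" by (rule measurable_borel)
    have f_L2: "f \<in> L2"
    proof (rule bounded_L2[OF f_meas])
      show "cmod (f z) \<le> 1" if "cmod z < 1" for z
        using F1[of "cmod z"] that by (simp add: cf F_def)
    qed
    have fp: "cmod (f z) powr p = cmod z powr (2 * real n)" for z
      using p by (simp add: cf powr_powr)
    have f_Lp: "f \<in> Lp_space p w"
      using f_meas moment_integrable[OF exps(2)] by (simp add: Lp_space_eq fp)
    have int: "(\<integral>z. F (cmod z) * cmod z ^ n \<partial>\<mu>) = moment ((1 + 2 / p) * n)"
    proof -
      have "F (cmod z) * cmod z ^ n = cmod z powr ((1 + 2 / p) * n)" for z
      proof (cases "z = 0")
        case False
        then have "F (cmod z) * cmod z ^ n = cmod z powr (2 * n / p + n)"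
          by (simp add: F_def powr_add powr_realpow)
        also have "2 * n / p + n = (1 + 2 / p) * n" by (simp add: ring_distribs)
        finally show ?thesis .
      qed (use n in \<open>simp add: F_def\<close>)
      then show ?thesis by (simp add: moment_def)
    qed
    have "(\<lambda>z. of_real c * z ^ n) holomorphic_on ball 0 1" by (intro holomorphic_intros)
    then have g_hol: "g holomorphic_on ball 0 1"
      by (rule holomorphic_transform) (simp add: g_def)
    have g_L2: "g \<in> L2"
    proof (rule continuous_bounded_L2[where B=c])
      show "continuous_on (ball 0 1) g" by (rule holomorphic_on_imp_continuous_on[OF g_hol])
      show "cmod (g z) \<le> c" if "cmod z < 1" for z
        using that c power_le_one[of "cmod z" n] by (simp add: g_def norm_mult norm_power mult_left_le)
    qed
    have "bergman_projection w f = g"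
    proof (rule bergman_projection_eqI[OF f_L2])
      show "g \<in> A2" using g_L2 g_hol by (simp add: A2_def)
      show "g z = 0" if "z \<notin> ball 0 1" for z using that by (simp add: g_def)
      show "ip (\<lambda>z. f z - g z) h = 0" if "h \<in> A2" for h
      proof -
        have "ip (\<lambda>z. f z - g z) h = ip (\<lambda>z. f z - of_real c * z ^ n) h"
          unfolding ip_def by (intro Bochner_Integration.integral_cong) (simp_all add: g_def space_\<mu>)
        also have "\<dots> = 0"
          using radial_projection[OF F F1 that n] n by (simp add: f_def int c_def monomial_sqnorm_eq_moment)
        finally show ?thesis .
      qed
    qed
    moreover have "Lp_norm p w f = moment (2 * real n) powr (1 / p)"
      by (simp add: Lp_norm_eq[OF f_meas] fp moment_def)
    moreover have "Lp_norm p w g = c * moment (p * n) powr (1 / p)"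
    proof -
      have gp: "cmod (g z) powr p = c powr p * cmod z powr (p * n)" if "z \<in> space \<mu>" for z
      proof (cases "z = 0")
        case False
        then show ?thesis using that c
          by (simp add: g_def space_\<mu> norm_mult norm_power powr_mult powr_powr mult.commute flip: powr_realpow)
      qed (use n in \<open>simp add: g_def\<close>)
      have "Lp_norm p w g = (\<integral>z. c powr p * cmod z powr (p * n) \<partial>\<mu>) powr (1 / p)"
        unfolding Lp_norm_eq[OF L2_measurable[OF g_L2]]
        by (subst Bochner_Integration.integral_cong[OF refl gp]) simp_all
      also have "\<dots> = (c powr p * moment (p * n)) powr (1 / p)" by (simp add: moment_def)
      also have "\<dots> = c * moment (p * n) powr (1 / p)"
        using c p moment_pos[OF exps(3)] by (simp add: powr_mult powr_powr)
      finally show ?thesis .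
    qed
    ultimately show ?thesis using C[of f] f_L2 f_Lp by (simp add: Lp_space_2 c_def)
  qed
  then show ?thesis using that by blast
qed

end

section \<open>Decay of the weight\<close>

lemma smooth_within_has_derivative:
  assumes "smooth_within {0..<1} \<phi>" "0 < r" "r < 1"
  shows "(nth_deriv_within {0..<1} n \<phi> has_real_derivative nth_deriv_within {0..<1} (Suc n) \<phi> r) (at r)"
proof -
  have "nth_deriv_within {0..<1} n \<phi> differentiable at r within {0..<1}"
    using assms by (auto simp: smooth_within_def differentiable_on_def)
  then have "(nth_deriv_within {0..<1} n \<phi> has_vector_derivative nth_deriv_within {0..<1} (Suc n) \<phi> r) (at r within {0..<1})"
    by (simp add: vector_derivative_works)
  moreover have "at r within {0..<1} = at r"
    using assms by (intro at_within_interior) (auto simp: interior_atLeastLessThan)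
  ultimately show ?thesis by (simp add: has_real_derivative_iff_has_vector_derivative)
qed

text \<open>The derivative of \<open>1 / d\<close> is \<open>- d2 / d\<^sup>2\<close>, of modulus
  below \<open>e\<close> near 1, and \<open>1 / d\<close> tends to 0 at 1. The mean value theorem on
  \<open>[r, s]\<close>, followed by letting \<open>s\<close> tend to 1, gives the bound.\<close>

lemma reciprocal_derivative_bound:
  fixes d d2 :: "real \<Rightarrow> real"
  assumes deriv: "\<And>r. \<lbrakk>0 < r; r < 1\<rbrakk> \<Longrightarrow> (d has_real_derivative d2 r) (at r)"
    and pos: "\<And>r. \<lbrakk>0 < r; r < 1\<rbrakk> \<Longrightarrow> d r > 0"
    and top: "filterlim d at_top (at_left 1)"
    and small: "((\<lambda>r. d2 r / (d r)\<^sup>2) \<longlongrightarrow> 0) (at_left 1)" and e: "e > 0"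
  shows "\<forall>\<^sub>F r in at_left 1. 1 / d r \<le> e * (1 - r)"
proof -
  have "\<forall>\<^sub>F r in at_left 1. norm (d2 r / (d r)\<^sup>2) < e"
    using order_tendstoD(2)[OF tendsto_norm[OF small]] e by simp
  then obtain r0 where r0: "r0 < 1" "\<And>r. \<lbrakk>r0 < r; r < 1\<rbrakk> \<Longrightarrow> norm (d2 r / (d r)\<^sup>2) < e"
    by (auto simp: eventually_at_left_field)
  have inv0: "((\<lambda>s. 1 / d s) \<longlongrightarrow> 0) (at_left 1)"
    using top by (intro tendsto_divide_0[OF tendsto_const]) (simp add: filterlim_at_top_imp_at_infinity)
  have "1 / d r \<le> e * (1 - r)" if r: "max 0 r0 < r" "r < 1" for r
  proof -
    have le: "1 / d r - e * (s - r) \<le> 1 / d s" if s: "r < s" "s < 1" for s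
    proof -
      have "((\<lambda>x. 1 / d x) has_real_derivative - (d2 x / (d x)\<^sup>2)) (at x)" if "r \<le> x" "x \<le> s" for x
        using that r s pos[of x] by (auto intro!: derivative_eq_intros deriv simp: power2_eq_square)
      then obtain x where x: "r < x" "x < s" "1 / d s - 1 / d r = (s - r) * - (d2 x / (d x)\<^sup>2)"
        using MVT2[OF s(1), of "\<lambda>x. 1 / d x" "\<lambda>x. - (d2 x / (d x)\<^sup>2)"] by blast
      have "norm (d2 x / (d x)\<^sup>2) < e" using x r s by (intro r0) auto
      then have "d2 x / (d x)\<^sup>2 \<le> e" unfolding real_norm_def by linarith
      then have "(s - r) * (d2 x / (d x)\<^sup>2) \<le> (s - r) * e" using s by (intro mult_left_mono) auto
      then show ?thesis using x(3) by (simp add: mult.commute)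
    qed
    have "((\<lambda>s. 1 / d r - e * (s - r)) \<longlongrightarrow> 1 / d r - e * (1 - r)) (at_left 1)"
      by (intro tendsto_intros)
    moreover have "\<forall>\<^sub>F s in at_left 1. 1 / d r - e * (s - r) \<le> 1 / d s"
      using r(2) le by (auto simp: eventually_at_left_field intro!: exI[of _ r])
    ultimately have "1 / d r - e * (1 - r) \<le> 0"
      by (intro tendsto_le[OF _ inv0]) auto
    then show ?thesis by simp
  qed
  then show ?thesis using r0(1)
    by (auto simp: eventually_at_left_field intro!: exI[of _ "max 0 r0"])
qed

text \<open>By \<open>reciprocal_derivative_bound\<close> with \<open>e = 1 / N\<close>,
  \<open>d r\<close> is at least \<open>N / (1 - r)\<close> near 1, so
  \<open>\<phi> r + N * ln (1 - r)\<close> is nondecreasing there; away from 1 nonnegativity of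
  \<open>\<phi>\<close> suffices.\<close>

lemma logarithmic_lower_bound:
  fixes \<phi> d d2 :: "real \<Rightarrow> real"
  assumes nonneg: "\<And>r. \<lbrakk>0 \<le> r; r < 1\<rbrakk> \<Longrightarrow> \<phi> r \<ge> 0"
    and deriv0: "\<And>r. \<lbrakk>0 < r; r < 1\<rbrakk> \<Longrightarrow> (\<phi> has_real_derivative d r) (at r)"
    and deriv: "\<And>r. \<lbrakk>0 < r; r < 1\<rbrakk> \<Longrightarrow> (d has_real_derivative d2 r) (at r)"
    and pos: "\<And>r. \<lbrakk>0 < r; r < 1\<rbrakk> \<Longrightarrow> d r > 0"
    and top: "filterlim d at_top (at_left 1)"
    and small: "((\<lambda>r. d2 r / (d r)\<^sup>2) \<longlongrightarrow> 0) (at_left 1)" and N: "N > 0"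
  obtains C where "\<And>r. \<lbrakk>0 \<le> r; r < 1\<rbrakk> \<Longrightarrow> \<phi> r \<ge> - N * ln (1 - r) - C"
proof -
  have "\<forall>\<^sub>F r in at_left 1. 1 / d r \<le> 1 / N * (1 - r)"
    using N by (intro reciprocal_derivative_bound[OF deriv pos top small]) auto
  then obtain r0 where r0: "r0 < 1" "\<And>r. \<lbrakk>r0 < r; r < 1\<rbrakk> \<Longrightarrow> 1 / d r \<le> 1 / N * (1 - r)"
    by (auto simp: eventually_at_left_field)
  define r1 where "r1 = (max 0 r0 + 1) / 2"
  have r1: "0 < r1" "r0 < r1" "r1 < 1" using r0(1) by (auto simp: r1_def max_def)
  \<comment> \<open>Then \<open>- C\<close> equals \<open>N * ln (1 - r1)\<close>, a lower bound of
    \<open>\<phi> r1 + N * ln (1 - r1)\<close>.\<close>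
  define C where "C = - N * ln (1 - r1)"
  have "\<phi> r \<ge> - N * ln (1 - r) - C" if r: "0 \<le> r" "r < 1" for r
  proof (cases "r \<le> r1")
    case True
    then have "ln (1 - r1) \<le> ln (1 - r)" using r r1 by simp
    then have "N * ln (1 - r1) \<le> N * ln (1 - r)" using N by (intro mult_left_mono) auto
    then show ?thesis using nonneg[OF r] by (simp add: C_def)
  next
    case False
    define h where "h x = \<phi> x + N * ln (1 - x)" for x
    have "h r1 \<le> h r"
    proof (rule DERIV_nonneg_imp_nondecreasing[of r1 r])
      fix x assume x: "r1 \<le> x" "x \<le> r"
      have x': "0 < x" "r0 < x" "x < 1" using x r1 r by auto
      have "(h has_real_derivative d x - N / (1 - x)) (at x)"
        unfolding h_def [abs_def] using x'
        by (auto intro!: derivative_eq_intros deriv0 simp: divide_inverse)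
      moreover have "1 / d x \<le> (1 - x) / N" using r0(2)[OF x'(2,3)] by simp
      then have "N / (1 - x) \<le> d x" using N pos[OF x'(1,3)] x' by (simp add: field_simps)
      ultimately show "\<exists>y. (h has_real_derivative y) (at x) \<and> 0 \<le> y" by (intro exI[of _ "d x - N / (1 - x)"]) auto
    qed (use False in auto)
    moreover have "\<phi> r1 \<ge> 0" using nonneg r1 by simp
    ultimately show ?thesis by (simp add: h_def C_def)
  qed
  then show ?thesis using that by blast
qed

text \<open>With \<open>x = n * (1 - t)\<close> one has \<open>t ^ n \<le> exp (- x)\<close> and
  \<open>x ^ N \<le> fact N * exp x\<close>; the exponentials cancel in the product.\<close>

lemma power_times_power_bound:
  fixes t :: real
  assumes "0 \<le> t" "t \<le> 1" "n > (0::nat)"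
  shows "t ^ n * (1 - t) ^ N \<le> fact N / real n ^ N"
proof -
  define x where "x = real n * (1 - t)"
  have x: "x \<ge> 0" using assms by (simp add: x_def)
  have "t ^ n \<le> exp (- (1 - t)) ^ n"
    using assms exp_ge_add_one_self[of "- (1 - t)"] by (intro power_mono) auto
  also have "\<dots> = exp (- x)" by (simp add: x_def exp_of_nat_mult[symmetric] right_diff_distrib)
  finally have 1: "t ^ n \<le> exp (- x)" .
  \<comment> \<open>A single term of the exponential series is at most the full sum.\<close>
  have "x ^ N / fact N \<le> exp x"
    using x sum_le_suminf[OF summable_exp[of x], of "{N}"]
    by (auto simp: exp_def divide_inverse scaleR_conv_of_real mult.commute)
  then have 2: "x ^ N \<le> fact N * exp x" by (simp add: field_simps)
  have "t ^ n * x ^ N \<le> exp (- x) * (fact N * exp x)"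
    using 1 2 x assms by (intro mult_mono) auto
  also have "\<dots> = fact N" by (simp add: exp_minus)
  finally have "(t ^ n * (1 - t) ^ N) * real n ^ N \<le> fact N"
    by (simp add: x_def power_mult_distrib mult_ac)
  then show ?thesis using assms by (simp add: pos_le_divide_eq)
qed

section \<open>Rapid decay of moments and the contradiction\<close>

context continuous_radial_weight begin

text \<open>The weight contributes \<open>(1 - cmod z) ^ (2 * N)\<close> and the moment
  \<open>cmod z ^ (2 * n)\<close>, so the integrand is controlled by the square of the quantity in
  \<open>power_times_power_bound\<close>.\<close>

lemma moment_upper_bound:
  assumes w: "\<And>z. z \<in> ball 0 1 \<Longrightarrow> w z \<le> A * (1 - cmod z) ^ (2 * N)" and n: "n > (0::nat)"
  shows "moment (2 * real n) \<le> A * (fact N)\<^sup>2 * measure disc_measure (ball 0 1) / real n ^ (2 * N)"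
proof -
  have A: "A \<ge> 0" using w[of 0] w_pos[of 0] by simp
  have "emeasure disc_measure (ball 0 1) = ennreal (1 / pi) * emeasure (lebesgue_on (ball 0 1)) (ball 0 1 :: complex set)"
    unfolding disc_measure_def by (intro emeasure_density_const) (simp add: sets_restrict_space_iff)
  then have fin: "emeasure disc_measure (ball 0 1) < \<infinity>"
    using emeasure_bounded_finite[of "ball (0 :: complex) 1"]
    by (simp add: emeasure_restrict_space ennreal_mult_less_top)
  have meas: "(\<lambda>z. cmod z powr (2 * real n)) \<in> borel_measurable disc_measure"
    by (rule borel_measurable_disc) measurable
  define B where "B = A * (fact N)\<^sup>2 / real n ^ (2 * N)"
  have B: "B \<ge> 0" using A by (simp add: B_def)
  have "moment (2 * real n) = (\<integral>z. w z *\<^sub>R cmod z powr (2 * real n) \<partial>disc_measure)"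
    unfolding moment_def by (rule integral_\<mu>[OF meas])
  also have "\<dots> \<le> (\<integral>z. B * indicator (ball 0 1) z \<partial>disc_measure)"
  proof (rule integral_mono)
    show "integrable disc_measure (\<lambda>z. w z *\<^sub>R cmod z powr (2 * real n))"
      using moment_integrable[of "2 * real n"] n integrable_\<mu>[OF meas] by simp
    show "integrable disc_measure (\<lambda>z. B * indicator (ball 0 1) z)"
      using fin by (intro integrable_mult_right integrable_real_indicator) (auto simp: sets_disc_measure)
    fix z assume "z \<in> space disc_measure"
    then have z: "cmod z < 1" by simp
    have "cmod z powr (2 * real n) = cmod z powr real (2 * n)" by simp
    also have "\<dots> = cmod z ^ (2 * n)" using n by (intro powr_realpow') auto
    finally have "w z *\<^sub>R cmod z powr (2 * real n) \<le> (A * (1 - cmod z) ^ (2 * N)) * cmod z ^ (2 * n)"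
      using w[of z] z by (auto intro!: mult_right_mono)
    also have "\<dots> = A * (cmod z ^ n * (1 - cmod z) ^ N)\<^sup>2"
      by (simp add: power_mult_distrib power_mult[symmetric] mult_ac)
    also have "\<dots> \<le> A * (fact N / real n ^ N)\<^sup>2"
      using z A power_times_power_bound[of "cmod z" n N] n by (intro mult_left_mono power_mono) auto
    also have "\<dots> = B" by (simp add: B_def power_divide power_mult[symmetric] mult.commute)
    finally show "w z *\<^sub>R cmod z powr (2 * real n) \<le> B * indicator (ball 0 1) z" using z by simp
  qed
  also have "\<dots> = B * measure disc_measure (ball 0 1)" by (simp add: Int_absorb2)
  finally show ?thesis by (simp add: B_def mult_ac)
qed

text \<open>For \<open>p\<close> other than 2, boundedness bounds the logarithms of the moments
  below by \<open>c - K * ln n\<close>, while the decay bounds them above by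
  \<open>ln D - 2 * N * ln n\<close>. A large \<open>N\<close> then bounds \<open>ln n\<close>,
  which is absurd.\<close>

lemma bergman_projection_bounded_imp_2:
  assumes bd: "bergman_projection_bounded p w" and p: "p > 0"
    and decay: "\<And>N. \<exists>A. \<forall>z\<in>ball 0 1. w z \<le> A * (1 - cmod z) ^ (2 * N)"
  shows "p = 2"
proof (rule ccontr)
  assume "p \<noteq> 2"
  obtain C where C: "\<And>n. n > (0::nat) \<Longrightarrow>
    moment ((1 + 2 / p) * n) / moment (2 * real n) * moment (p * n) powr (1 / p) \<le> C * moment (2 * real n) powr (1 / p)"
    by (rule bounded_imp_moment_inequality[OF bd p], rule that, assumption+)
  obtain c K where cK: "\<And>n. n > (0::nat) \<Longrightarrow> ln (moment (2 * real n)) \<ge> c - K * ln n"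
    by (rule moment_inequality_imp_power_lower_bound[OF p \<open>p \<noteq> 2\<close> C], assumption, rule that, assumption+)
  \<comment> \<open>This makes \<open>2 * N - K\<close> at least 1, so that \<open>ln n\<close>
    itself is bounded.\<close>
  obtain N :: nat where N: "K + 1 < N" using reals_Archimedean2 by blast
  obtain A where A: "\<And>z. z \<in> ball 0 1 \<Longrightarrow> w z \<le> A * (1 - cmod z) ^ (2 * N)" using decay by blast
  define D where "D = A * (fact N)\<^sup>2 * measure disc_measure (ball 0 1)"
  have le: "ln n \<le> ln D - c" if n: "n > 0" for n :: nat
  proof -
    have M: "moment (2 * real n) > 0" "moment (2 * real n) \<le> D / real n ^ (2 * N)"
      using moment_pos[of "2 * real n"] moment_upper_bound[OF A n] n by (auto simp: D_def)
    then have "D / real n ^ (2 * N) > 0" by linarith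
    then have D: "D > 0" using n by (simp add: zero_less_divide_iff)
    have "c - K * ln n \<le> ln (moment (2 * real n))" by (rule cK[OF n])
    also have "\<dots> \<le> ln (D / real n ^ (2 * N))" using M by simp
    also have "\<dots> = ln D - 2 * N * ln n" using D n by (simp add: ln_div ln_realpow)
    finally have "(2 * real N - K) * ln n \<le> ln D - c" by (simp add: algebra_simps)
    moreover have "1 * ln n \<le> (2 * real N - K) * ln n" using N n by (intro mult_right_mono) auto
    ultimately show ?thesis by simp
  qed
  obtain n :: nat where "exp (ln D - c) < n" using reals_Archimedean2 by blast
  moreover from this have "n > 0" by (auto intro: Nat.gr0I order.strict_trans1)
  ultimately have "ln D - c < ln n" using ln_less_cancel_iff[of "exp (ln D - c)" "real n"] by simp
  with le[OF \<open>n > 0\<close>] show False by simp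
qed

end

theorem proposition2:
  fixes w :: "complex \<Rightarrow> real" and \<phi> :: "real \<Rightarrow> real" and p :: real
  assumes "weight w" and "radial w"
    and "\<And>z. z \<in> ball 0 1 \<Longrightarrow> w z = exp (- 2 * \<phi> (cmod z))"
    and "\<And>r. r \<in> {0..<1} \<Longrightarrow> \<phi> r \<ge> 0"
    and "smooth_within {0..<1} \<phi>"
    and "\<And>r. r \<in> {0..<1} \<Longrightarrow> nth_deriv_within {0..<1} 1 \<phi> r > 0"
    and "filterlim \<phi> at_top (at_left 1)"
    and "filterlim (nth_deriv_within {0..<1} 1 \<phi>) at_top (at_left 1)"
    and "\<And>n::nat. n \<ge> 2 \<Longrightarrow>
      ((\<lambda>r. nth_deriv_within {0..<1} n \<phi> r / (nth_deriv_within {0..<1} 1 \<phi> r) ^ n)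
        \<longlongrightarrow> 0) (at_left 1)"
    and "0 < p"
  shows "bergman_projection_bounded p w \<longleftrightarrow> p = 2"
proof -
  have "continuous_on {0..<1} \<phi>"
    using assms(5) unfolding smooth_within_def
    by (metis differentiable_imp_continuous_on nth_deriv_within.simps(1))
  then have "continuous_on (ball 0 1) (\<lambda>z::complex. \<phi> (cmod z))"
    by (rule continuous_on_compose2) (auto intro!: continuous_intros)
  then have "continuous_on (ball 0 1) (\<lambda>z::complex. exp (- 2 * \<phi> (cmod z)))"
    by (intro continuous_intros)
  then have "continuous_on (ball 0 1) w"
    by (rule continuous_on_cong[THEN iffD1, rotated 2]) (simp_all add: assms(3))
  then interpret continuous_radial_weight w
    using assms(1,2) by unfold_locales
  let ?d = "nth_deriv_within {0..<1}"
  have deriv: "(?d n \<phi> has_real_derivative ?d (Suc n) \<phi> r) (at r)" if "0 < r" "r < 1" for n r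
    by (rule smooth_within_has_derivative[OF assms(5) that])
  have decay: "\<exists>A. \<forall>z\<in>ball 0 1. w z \<le> A * (1 - cmod z) ^ (2 * N)" for N
  proof -
    \<comment> \<open>\<open>Suc N\<close> keeps the multiplier positive also for
      \<open>N = 0\<close>; the surplus power of \<open>t\<close> is dropped afterwards because
      \<open>t \<le> 1\<close>.\<close>
    obtain C where C: "\<And>r. \<lbrakk>0 \<le> r; r < 1\<rbrakk> \<Longrightarrow> \<phi> r \<ge> - real (Suc N) * ln (1 - r) - C"
    proof (rule logarithmic_lower_bound)
      show "\<phi> r \<ge> 0" if "0 \<le> r" "r < 1" for r using assms(4)[of r] that by simp
      show "(\<phi> has_real_derivative ?d 1 \<phi> r) (at r)" if "0 < r" "r < 1" for r
        using deriv[OF that, of 0] by simp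
      show "(?d 1 \<phi> has_real_derivative ?d 2 \<phi> r) (at r)" if "0 < r" "r < 1" for r
        using deriv[OF that, of 1] by (simp add: numeral_2_eq_2)
      show "?d 1 \<phi> r > 0" if "0 < r" "r < 1" for r using assms(6)[of r] that by simp
      show "filterlim (?d 1 \<phi>) at_top (at_left 1)" by (rule assms(8))
      show "((\<lambda>r. ?d 2 \<phi> r / (?d 1 \<phi> r)\<^sup>2) \<longlongrightarrow> 0) (at_left 1)" by (rule assms(9)) simp
      show "real (Suc N) > 0" by simp
    qed (rule that, assumption+)
    have "w z \<le> exp (2 * C) * (1 - cmod z) ^ (2 * N)" if z: "z \<in> ball 0 1" for z
    proof -
      define t where "t = 1 - cmod z"
      have t: "t > 0" "t \<le> 1" using z by (auto simp: t_def)
      have "w z = exp (- 2 * \<phi> (cmod z))" by (rule assms(3)[OF z])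
      also have "\<dots> \<le> exp (2 * C + real (2 * Suc N) * ln t)"
        using C[of "cmod z"] z by (simp add: t_def algebra_simps)
      also have "\<dots> = exp (2 * C) * t ^ (2 * Suc N)"
        using t by (simp only: exp_add exp_of_nat_mult exp_ln)
      also have "\<dots> \<le> exp (2 * C) * t ^ (2 * N)"
        using t by (intro mult_left_mono power_decreasing) auto
      finally show ?thesis by (simp add: t_def)
    qed
    then show ?thesis by blast
  qed
  show ?thesis using bergman_projection_bounded_imp_2[OF _ assms(10) decay] bergman_projection_bounded_2 by blast
qed

end
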